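(* Let $\alpha>0$ and let $\mathcal{G}=\{\mathbf{x}_1,\dots,\mathbf{x}_N\}\subset\bar\Omega$ contain at least three non-collinear points if $d=2$, and at least four non-coplanar points if $d=3$. Let $W_h=\mathcal{L}_h$ or $W_h=\mathcal{Q}_h$, and let $\mathbf{z}\in\mathbb{R}^N$. Then the variational problem of finding $u_h\in W_h$ such that $$a(u_h,v_h)=(Pv_h)^T\mathbf{z}\quad\text{for all } v_h\in W_h$$ admits a unique solution, and this solution depends continuously on the data $\mathbf{z}$. Here $$a(u_h,v_h)=(Pu_h)^TPv_h+\alpha\int_\Omega\nabla(R_h\nabla u_h):\nabla(R_h\nabla v_h)\,d\mathbf{x}+\int_\Omega(R_h\nabla u_h-\nabla u_h)\cdot(R_h\nabla v_h-\nabla v_h)\,d\mathbf{x}.$$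
   Context: $\Omega\subset\mathbb{R}^d$, $d\in\{2,3\}$, is a closed and bounded region (connected) with polygonal or polyhedral boundary. $\mathcal{T}_h$ is a quasi-uniform partition of $\Omega$ into $d$-simplices with mesh-size $h$. $\mathcal{L}_h$ and $\mathcal{Q}_h$ are the spaces of continuous functions on $\Omega$ whose restriction to each $T\in\mathcal{T}_h$ is a polynomial of degree at most $1$, respectively at most $2$. $Pu=(u(\mathbf{x}_1),\dots,u(\mathbf{x}_N))^T\in\mathbb{R}^N$ is the vector of values of a continuous function $u$ at the points of $\mathcal{G}$. For matrix-valued functions, $\boldsymbol\alpha:\boldsymbol\beta=\sum_{i,j}\alpha_{ij}\beta_{ij}$. $\mathcal{M}_h\subset L^2(\Omega)$ is a piecewise polynomial space with respect to $\mathcal{T}_h$ such that: (i) $\dim\mathcal{M}_h=\dim\mathcal{L}_h$; (ii) there is $\beta>0$ independent of $\mathcal{T}_h$ with $\|\phi_h\|_{L^2(\Omega)}\le\beta\sup_{\mu_h\in\mathcal{M}_h\setminus\{0\}}\frac{\int_\Omega\mu_h\phi_h\,d\mathbf{x}}{\|\mu_h\|_{L^2(\Omega)}}$ for all $\phi_h\in\mathcal{L}_h$; (iii) $\inf_{\lambda_h\in\mathcal{M}_h}\|\phi-\lambda_h\|_{L^2(\Omega)}\le Ch|\phi|_{H^1(\Omega)}$ for all $\phi\in H^1(\Omega)$, with $C$ independent of $h$. The operator $R_h:L^2(\Omega)\to\mathcal{L}_h$ is defined by $\int_\Omega (R_hv)\,\mu_h\,d\mathbf{x}=\int_\Omega v\,\mu_h\,d\mathbf{x}$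 for all $\mu_h\in\mathcal{M}_h$; it is well-defined by (i) and (ii), and is applied to vector-valued functions componentwise. *)

theory Defs
  imports "HOL-Analysis.Analysis" "HOL-Library.Function_Algebras"
begin

(* Pointwise scaling: makes subspace and dim available for spaces of functions. *)
instantiation "fun" :: (type, real_vector) real_vector
begin

definition scaleR_fun :: "real \<Rightarrow> ('a \<Rightarrow> 'b) \<Rightarrow> 'a \<Rightarrow> 'b"
  where "scaleR_fun c f = (\<lambda>x. c *\<^sub>R f x)"

instance
  by standard (simp_all add: scaleR_fun_def fun_eq_iff scaleR_add_right scaleR_add_left)

end


definition polyhedral_region :: "(real^'d) set \<Rightarrow> bool"
  where "polyhedral_region \<Omega> \<longleftrightarrow>
    closed \<Omega> \<and> bounded \<Omega> \<and> connected \<Omega> \<and> \<Omega> = closure (interior \<Omega>) \<and>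
    (\<exists>F. finite F \<and> (\<forall>P\<in>F. polytope P \<and> aff_dim P = int CARD('d) - 1) \<and> frontier \<Omega> = \<Union>F)"

(* Hanging nodes are not excluded; every conforming triangulation is a partition in this sense. *)
definition simplicial_partition :: "(real^'d) set \<Rightarrow> (real^'d) set set \<Rightarrow> bool"
  where "simplicial_partition \<Omega> \<T> \<longleftrightarrow>
    finite \<T> \<and> \<T> \<noteq> {} \<and> (\<forall>T\<in>\<T>. int CARD('d) simplex T) \<and>
    (\<forall>S\<in>\<T>. \<forall>T\<in>\<T>. S \<noteq> T \<longrightarrow> interior S \<inter> interior T = {}) \<and> \<Union>\<T> = \<Omega>"

definition mesh_size :: "(real^'d) set set \<Rightarrow> real"
  where "mesh_size \<T> = Max (diameter ` \<T>)"

(* A family of partitions indexed by its mesh-sizes h \<in> H; the shape constant \<rho> is uniform in h. *)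
definition quasi_uniform_partitions ::
    "(real^'d) set \<Rightarrow> real set \<Rightarrow> (real \<Rightarrow> (real^'d) set set) \<Rightarrow> bool"
  where "quasi_uniform_partitions \<Omega> H \<T> \<longleftrightarrow>
    (\<forall>h\<in>H. simplicial_partition \<Omega> (\<T> h) \<and> mesh_size (\<T> h) = h) \<and>
    (\<exists>\<rho>>0. \<forall>h\<in>H. \<forall>T\<in>\<T> h. \<exists>c. cball c (\<rho> * h) \<subseteq> T)"


definition polys :: "nat \<Rightarrow> (real^'d \<Rightarrow> real) set"
  where "polys k = {p. \<exists>c. \<forall>x. p x =
    (\<Sum>m | (\<Sum>i\<in>UNIV. m i) \<le> k. c m * (\<Prod>i\<in>UNIV. (x $ i) ^ m i))}"

(* Functions on \<Omega> are represented by their extension by zero, so that equality of functions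
   and the dimension of the space are those of functions on \<Omega>. *)
definition lagrange_space ::
    "nat \<Rightarrow> (real^'d) set \<Rightarrow> (real^'d) set set \<Rightarrow> (real^'d \<Rightarrow> real) set"
  where "lagrange_space k \<Omega> \<T> =
    {u. continuous_on \<Omega> u \<and> (\<forall>T\<in>\<T>. \<exists>p\<in>polys k. \<forall>x\<in>T. u x = p x) \<and> (\<forall>x. x \<notin> \<Omega> \<longrightarrow> u x = 0)}"

abbreviation "\<L> \<equiv> lagrange_space 1"
abbreviation "\<Q> \<equiv> lagrange_space 2"

(* Discontinuous piecewise polynomials are elements of L2, so values on element faces (a null set)
   are irrelevant. The representative vanishing off the element interiors is used; for it, equality
   almost everywhere is equality, and dim is the dimension of the subspace of L2. *)
definition piecewise_polynomial :: "(real^'d) set set \<Rightarrow> (real^'d \<Rightarrow> real) \<Rightarrow> bool"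
  where "piecewise_polynomial \<T> \<mu> \<longleftrightarrow>
    (\<forall>T\<in>\<T>. \<exists>k. \<exists>p\<in>polys k. \<forall>x\<in>interior T. \<mu> x = p x) \<and>
    (\<forall>x. x \<notin> (\<Union>T\<in>\<T>. interior T) \<longrightarrow> \<mu> x = 0)"


definition L2 :: "(real^'d) set \<Rightarrow> (real^'d \<Rightarrow> 'b::euclidean_space) set"
  where "L2 \<Omega> = {f. f \<in> borel_measurable (lebesgue_on \<Omega>) \<and>
    integrable (lebesgue_on \<Omega>) (\<lambda>x. (norm (f x))\<^sup>2)}"

definition L2_norm :: "(real^'d) set \<Rightarrow> (real^'d \<Rightarrow> 'b::euclidean_space) \<Rightarrow> real"
  where "L2_norm \<Omega> f = sqrt (LINT x|lebesgue_on \<Omega>. (norm (f x))\<^sup>2)"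

(* Classical pointwise gradient, with unspecified value where f is not differentiable. A continuous
   piecewise polynomial is smooth in the element interiors, hence almost everywhere, and this is
   then a representative of its weak gradient. *)
definition grad :: "(real^'d \<Rightarrow> real) \<Rightarrow> real^'d \<Rightarrow> real^'d"
  where "grad f x = (\<chi> i. frechet_derivative f (at x) (axis i 1))"

definition grad_vec :: "(real^'d \<Rightarrow> real^'d) \<Rightarrow> real^'d \<Rightarrow> real^'d^'d"
  where "grad_vec w x = (\<chi> i. grad (\<lambda>y. w y $ i) x)"

definition frobenius :: "real^'d^'d \<Rightarrow> real^'d^'d \<Rightarrow> real"
  where "frobenius A B = (\<Sum>i\<in>UNIV. \<Sum>j\<in>UNIV. A $ i $ j * B $ i $ j)"

primrec C_k :: "nat \<Rightarrow> (real^'d \<Rightarrow> real) \<Rightarrow> bool"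
  where
    "C_k 0 f \<longleftrightarrow> continuous_on UNIV f"
  | "C_k (Suc n) f \<longleftrightarrow> (\<forall>x. f differentiable (at x)) \<and> (\<forall>i. C_k n (\<lambda>x. grad f x $ i))"

definition test_functions :: "(real^'d) set \<Rightarrow> (real^'d \<Rightarrow> real) set"
  where "test_functions U =
    {\<psi>. (\<forall>n. C_k n \<psi>) \<and> (\<exists>K. compact K \<and> K \<subseteq> U \<and> (\<forall>x. x \<notin> K \<longrightarrow> \<psi> x = 0))}"

definition is_weak_gradient ::
    "(real^'d) set \<Rightarrow> (real^'d \<Rightarrow> real) \<Rightarrow> (real^'d \<Rightarrow> real^'d) \<Rightarrow> bool"
  where "is_weak_gradient \<Omega> \<phi> g \<longleftrightarrow> (\<forall>\<psi>\<in>test_functions (interior \<Omega>). \<forall>i.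
    (LINT x|lebesgue_on \<Omega>. \<phi> x * grad \<psi> x $ i) = - (LINT x|lebesgue_on \<Omega>. g x $ i * \<psi> x))"

definition H1 :: "(real^'d) set \<Rightarrow> (real^'d \<Rightarrow> real) set"
  where "H1 \<Omega> = {\<phi> \<in> L2 \<Omega>. \<exists>g\<in>L2 \<Omega>. is_weak_gradient \<Omega> \<phi> g}"

(* The weak gradient is unique up to null sets, so its norm does not depend on the choice. *)
definition H1_seminorm :: "(real^'d) set \<Rightarrow> (real^'d \<Rightarrow> real) \<Rightarrow> real"
  where "H1_seminorm \<Omega> \<phi> = L2_norm \<Omega> (SOME g. g \<in> L2 \<Omega> \<and> is_weak_gradient \<Omega> \<phi> g)"

(* The H1 norm of a continuous piecewise polynomial, for which grad is the weak gradient. *)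
definition fe_H1_norm :: "(real^'d) set \<Rightarrow> (real^'d \<Rightarrow> real) \<Rightarrow> real"
  where "fe_H1_norm \<Omega> u = sqrt ((L2_norm \<Omega> u)\<^sup>2 + (L2_norm \<Omega> (grad u))\<^sup>2)"


definition inf_sup_condition ::
    "(real^'d) set \<Rightarrow> (real^'d) set set \<Rightarrow> (real^'d \<Rightarrow> real) set \<Rightarrow> real \<Rightarrow> bool"
  where "inf_sup_condition \<Omega> \<T> M \<beta> \<longleftrightarrow> (\<forall>\<phi>\<in>\<L> \<Omega> \<T>.
    L2_norm \<Omega> \<phi> \<le> \<beta> * (SUP \<mu>\<in>M - {0}. (LINT x|lebesgue_on \<Omega>. \<mu> x * \<phi> x) / L2_norm \<Omega> \<mu>))"

definition approximation_property ::
    "(real^'d) set \<Rightarrow> (real^'d \<Rightarrow> real) set \<Rightarrow> real \<Rightarrow> real \<Rightarrow> bool"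
  where "approximation_property \<Omega> M C h \<longleftrightarrow> (\<forall>\<phi>\<in>H1 \<Omega>.
    (INF \<mu>\<in>M. L2_norm \<Omega> (\<lambda>x. \<phi> x - \<mu> x)) \<le> C * h * H1_seminorm \<Omega> \<phi>)"

definition R_op ::
    "(real^'d) set \<Rightarrow> (real^'d) set set \<Rightarrow> (real^'d \<Rightarrow> real) set \<Rightarrow> (real^'d \<Rightarrow> real) \<Rightarrow> real^'d \<Rightarrow> real"
  where "R_op \<Omega> \<T> M v = (THE w. w \<in> \<L> \<Omega> \<T> \<and>
    (\<forall>\<mu>\<in>M. (LINT x|lebesgue_on \<Omega>. w x * \<mu> x) = (LINT x|lebesgue_on \<Omega>. v x * \<mu> x)))"

definition R_vec ::
    "(real^'d) set \<Rightarrow> (real^'d) set set \<Rightarrow> (real^'d \<Rightarrow> real) set \<Rightarrow> (real^'d \<Rightarrow> real^'d)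
      \<Rightarrow> real^'d \<Rightarrow> real^'d"
  where "R_vec \<Omega> \<T> M v x = (\<chi> i. R_op \<Omega> \<T> M (\<lambda>y. v y $ i) x)"

definition P_vec :: "('N \<Rightarrow> real^'d) \<Rightarrow> (real^'d \<Rightarrow> real) \<Rightarrow> real^'N"
  where "P_vec x u = (\<chi> k. u (x k))"

definition a_form ::
    "(real^'d) set \<Rightarrow> (real^'d) set set \<Rightarrow> (real^'d \<Rightarrow> real) set \<Rightarrow> real \<Rightarrow> ('N::finite \<Rightarrow> real^'d)
      \<Rightarrow> (real^'d \<Rightarrow> real) \<Rightarrow> (real^'d \<Rightarrow> real) \<Rightarrow> real"
  where "a_form \<Omega> \<T> M \<alpha> x u v =
    P_vec x u \<bullet> P_vec x v
    + \<alpha> * (LINT y|lebesgue_on \<Omega>. frobenius (grad_vec (R_vec \<Omega> \<T> M (grad u)) y)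
                                           (grad_vec (R_vec \<Omega> \<T> M (grad v)) y))
    + (LINT y|lebesgue_on \<Omega>. (R_vec \<Omega> \<T> M (grad u) y - grad u y)
                              \<bullet> (R_vec \<Omega> \<T> M (grad v) y - grad v y))"

definition is_solution ::
    "(real^'d) set \<Rightarrow> (real^'d) set set \<Rightarrow> (real^'d \<Rightarrow> real) set \<Rightarrow> real \<Rightarrow> ('N::finite \<Rightarrow> real^'d)
      \<Rightarrow> (real^'d \<Rightarrow> real) set \<Rightarrow> real^'N \<Rightarrow> (real^'d \<Rightarrow> real) \<Rightarrow> bool"
  where "is_solution \<Omega> \<T> M \<alpha> x W z u \<longleftrightarrow>
    u \<in> W \<and> (\<forall>v\<in>W. a_form \<Omega> \<T> M \<alpha> x u v = P_vec x v \<bullet> z)"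

end

theory Submission
  imports Defs
begin

text \<open>
For fixed \<open>h\<close> the problem lives in a finite-dimensional space \<open>W\<close>. On such a space a linear equation is
uniquely solvable as soon as the homogeneous one has only the zero solution, and the solution is then a
linear, hence Lipschitz, function of \<open>z\<close>. So the theorem reduces to the definiteness of \<open>a\<close>:
\<open>a(u, u) = 0\<close> forces \<open>u = 0\<close> (\<open>definite_form_well_posed\<close>, \<open>a_form_definite\<close>).

The three terms of \<open>a(u, u)\<close> are nonnegative, so they vanish separately. The second one says that each
component of the recovered gradient \<open>R_h \<nabla>u\<close>, an element of \<open>\<L>\<^sub>h\<close>, has zero gradient almost everywhere.
Such a function is constant on every simplex and continuous on the connected set \<open>\<Omega>\<close>; a continuous function
with finitely many values on a connected set is constant. The third term then says that \<open>\<nabla>u\<close> equals a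
constant vector \<open>c\<close> almost everywhere, and the same argument applied to \<open>u(x) - c \<bullet> x\<close> shows that \<open>u\<close> is
affine on \<open>\<Omega>\<close> (\<open>constant_gradient_imp_affine\<close>). The first term makes this affine function vanish at
points that lie on no common hyperplane, so it is zero.

The argument presupposes that \<open>a\<close> is bilinear, which rests on \<open>R_h\<close> being well defined and linear. Existence
and uniqueness of \<open>R_h v\<close> come from the same piece of linear algebra as the theorem itself: \<open>\<L>\<^sub>h\<close> and \<open>\<M>\<^sub>h\<close>
have equal finite dimension and the inf-sup condition makes their \<open>L\<^sup>2\<close> pairing nondegenerate
(\<open>nondegenerate_pairing_represents\<close>, \<open>inf_sup_nondegenerate\<close>). The gradient of a finite element function
is additive only where the functions are differentiable, that is, almost everywhere; maps
which are linear up to null sets (\<open>ae_linear_on\<close>) make the integrals of their products honest bilinear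
forms, and both \<open>a\<close> and the square of the \<open>H\<^sup>1\<close> norm are sums of such integrals.
\<close>

section \<open>Linear and bilinear forms on a subspace\<close>

lemma sum_fun_eval: "(\<Sum>i\<in>S. f i) y = (\<Sum>i\<in>S. f i y)"
  by (induction S rule: infinite_finite_induct) auto

text \<open>Linearity is required on a subspace only: the forms at hand are integrals, whose additivity is available
just for integrable functions, so they are not linear on the whole function space.\<close>

definition linear_form_on :: "'a::real_vector set \<Rightarrow> ('a \<Rightarrow> real) \<Rightarrow> bool"
  where "linear_form_on V f \<longleftrightarrow>
    (\<forall>u\<in>V. \<forall>v\<in>V. f (u + v) = f u + f v) \<and> (\<forall>c. \<forall>u\<in>V. f (c *\<^sub>R u) = c * f u)"

lemma linear_form_on_zero:
  assumes "subspace V" "linear_form_on V f"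
  shows "f 0 = 0"
  using assms unfolding linear_form_on_def by (metis mult_zero_left scaleR_zero_left subspace_0)

lemma linear_form_on_combination:
  assumes V: "subspace V" and f: "linear_form_on V f" and g: "\<And>i. i \<in> S \<Longrightarrow> g i \<in> V"
  shows "f (\<Sum>i\<in>S. c i *\<^sub>R g i) = (\<Sum>i\<in>S. c i * f (g i))"
  using g
proof (induction S rule: infinite_finite_induct)
  case (insert i S)
  have "(\<Sum>i\<in>S. c i *\<^sub>R g i) \<in> V" "c i *\<^sub>R g i \<in> V"
    using V insert.prems by (auto intro!: subspace_sum subspace_scale)
  then have "f (c i *\<^sub>R g i + (\<Sum>i\<in>S. c i *\<^sub>R g i)) = c i * f (g i) + f (\<Sum>i\<in>S. c i *\<^sub>R g i)"
    using f insert.prems unfolding linear_form_on_def by auto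
  with insert show ?case by simp
qed (simp_all add: linear_form_on_zero[OF V f])

lemma linear_form_on_diff:
  assumes "subspace V" "linear_form_on V f" "u \<in> V" "v \<in> V"
  shows "f (u - v) = f u - f v"
proof -
  have "f (u + (-1) *\<^sub>R v) = f u + (-1) * f v"
    using assms unfolding linear_form_on_def by (metis subspace_scale)
  then show ?thesis by simp
qed

text \<open>The set on which two linear forms agree is a subspace, so agreement on a spanning set suffices.\<close>

lemma linear_form_on_eqI:
  assumes V: "subspace V" and f: "linear_form_on V f" and g: "linear_form_on V g"
    and B: "B \<subseteq> V" "V \<subseteq> span B" and eq: "\<And>b. b \<in> B \<Longrightarrow> f b = g b" and u: "u \<in> V"
  shows "f u = g u"
proof -
  have "subspace {w \<in> V. f w = g w}"
    using V f g linear_form_on_zero[OF V f] linear_form_on_zero[OF V g]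
    unfolding subspace_def linear_form_on_def by auto
  then have "span B \<subseteq> {w \<in> V. f w = g w}"
    using B eq by (intro span_minimal) auto
  then show ?thesis using B u by auto
qed

lemma linear_form_on_add:
  "linear_form_on V f \<Longrightarrow> linear_form_on V g \<Longrightarrow> linear_form_on V (\<lambda>u. f u + g u)"
  unfolding linear_form_on_def by (simp add: algebra_simps)

lemma linear_form_on_cmult: "linear_form_on V f \<Longrightarrow> linear_form_on V (\<lambda>u. c * f u)"
  unfolding linear_form_on_def by (simp add: algebra_simps)

lemma linear_form_on_sum:
  "(\<And>i. i \<in> I \<Longrightarrow> linear_form_on V (f i)) \<Longrightarrow> linear_form_on V (\<lambda>u. \<Sum>i\<in>I. f i u)"
  unfolding linear_form_on_def by (simp add: sum.distrib sum_distrib_left)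

definition bilinear_form_on ::
    "'a::real_vector set \<Rightarrow> 'b::real_vector set \<Rightarrow> ('a \<Rightarrow> 'b \<Rightarrow> real) \<Rightarrow> bool"
  where "bilinear_form_on V M b \<longleftrightarrow>
    (\<forall>\<mu>\<in>M. linear_form_on V (\<lambda>u. b u \<mu>)) \<and> (\<forall>u\<in>V. linear_form_on M (b u))"

lemma bilinear_form_on_cong:
  assumes V: "subspace V" and M: "subspace M" and eq: "\<And>u v. u \<in> V \<Longrightarrow> v \<in> M \<Longrightarrow> b u v = c u v"
    and c: "bilinear_form_on V M c"
  shows "bilinear_form_on V M b"
  using c eq subspace_add[OF V] subspace_scale[OF V] subspace_add[OF M] subspace_scale[OF M]
  unfolding bilinear_form_on_def linear_form_on_def by simp

lemma bilinear_form_on_add: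
  "bilinear_form_on V M b \<Longrightarrow> bilinear_form_on V M c \<Longrightarrow> bilinear_form_on V M (\<lambda>u v. b u v + c u v)"
  unfolding bilinear_form_on_def by (simp add: linear_form_on_add)

lemma bilinear_form_on_cmult:
  "bilinear_form_on V M b \<Longrightarrow> bilinear_form_on V M (\<lambda>u v. c * b u v)"
  unfolding bilinear_form_on_def by (simp add: linear_form_on_cmult)

lemma bilinear_form_on_sum:
  "(\<And>i. i \<in> I \<Longrightarrow> bilinear_form_on V M (b i)) \<Longrightarrow> bilinear_form_on V M (\<lambda>u v. \<Sum>i\<in>I. b i u v)"
  unfolding bilinear_form_on_def by (simp add: linear_form_on_sum)

section \<open>Nondegenerate pairings and definite forms in finite dimension\<close>

text \<open>A vector of the span of \<open>T\<close> outside the span of \<open>S\<close> would extend \<open>S\<close> to an independent set with more than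
\<open>card T\<close> elements.\<close>

lemma span_superset_if_independent_card_eq:
  assumes S: "independent S" and T: "finite T" "S \<subseteq> span T" "card S = card T"
  shows "span T \<subseteq> span S"
proof
  fix t assume t: "t \<in> span T"
  show "t \<in> span S"
  proof (rule ccontr)
    assume "t \<notin> span S"
    then have "independent (insert t S)" "t \<notin> S"
      using S independent_insertI span_base by blast+
    moreover have "insert t S \<subseteq> span T" using t T by simp
    moreover have "finite S" using independent_span_bound[OF T(1) S T(2)] by simp
    ultimately show False
      using independent_span_bound[OF T(1), of "insert t S"] T(3) by simp
  qed
qed

lemma finite_basis:
  assumes "finite S" "V \<subseteq> span S"
  obtains B where "finite B" "B \<subseteq> V" "independent B" "V \<subseteq> span B" "card B = dim V"
proof -
  obtain B where B: "B \<subseteq> V" "independent B" "V \<subseteq> span B" "card B = dim V"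
    using basis_exists by blast
  have "finite B"
    using independent_span_bound[OF assms(1) B(2)] B(1) assms(2) by auto
  with B that show ?thesis by blast
qed

text \<open>Nondegeneracy in the first argument makes the map from \<open>V\<close> to the dual of \<open>M\<close> injective; equality of the
dimensions makes it bijective, so every linear form on \<open>M\<close> is represented by exactly one element of \<open>V\<close>. This
is used twice: with the \<open>L\<^sup>2\<close> pairing of \<open>\<L>\<^sub>h\<close> and \<open>\<M>\<^sub>h\<close> it defines \<open>R_h\<close>, and with \<open>V = M\<close> it solves the
variational problem.\<close>

theorem nondegenerate_pairing_represents:
  fixes V :: "'a::real_vector set" and M :: "'b::real_vector set"
  assumes V: "subspace V" "finite S" "V \<subseteq> span S" and M: "subspace M" "finite R" "M \<subseteq> span R"
    and dim: "dim M = dim V" and b: "bilinear_form_on V M b"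
    and nondeg: "\<And>u. u \<in> V \<Longrightarrow> (\<And>\<mu>. \<mu> \<in> M \<Longrightarrow> b u \<mu> = 0) \<Longrightarrow> u = 0"
    and F: "linear_form_on M F"
  shows "\<exists>!u. u \<in> V \<and> (\<forall>\<mu>\<in>M. b u \<mu> = F \<mu>)"
proof (rule ex_ex1I)
  obtain B where B: "finite B" "B \<subseteq> V" "independent B" "V \<subseteq> span B" "card B = dim V"
    using finite_basis[OF V(2,3)] .
  obtain D where D: "finite D" "D \<subseteq> M" "independent D" "M \<subseteq> span D" "card D = dim M"
    using finite_basis[OF M(2,3)] .
  have lin1: "linear_form_on V (\<lambda>u. b u \<mu>)" if "\<mu> \<in> M" for \<mu>
    using b that unfolding bilinear_form_on_def by blast
  have lin2: "linear_form_on M (b u)" if "u \<in> V" for u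
    using b that unfolding bilinear_form_on_def by blast
  \<comment> \<open>\<open>A u\<close> lists the values of \<open>b u\<close> on the basis \<open>D\<close> of \<open>M\<close>, extended by zero; the functions of this kind are
    spanned by the \<open>\<delta> \<mu>\<close> with \<open>\<mu> \<in> D\<close>. It remains to count: \<open>A\<close> maps the basis \<open>B\<close> to an independent set of the
    same size as \<open>D\<close>, which therefore spans all lists of values, that of \<open>F\<close> included.\<close>
  define A where "A u = (\<lambda>\<mu>. if \<mu> \<in> D then b u \<mu> else 0)" for u
  define \<delta> where "\<delta> \<mu> = (\<lambda>\<nu>. if \<nu> = \<mu> then 1 else 0 :: real)" for \<mu> :: 'b
  have comb_in_V: "(\<Sum>e\<in>B. c e *\<^sub>R e) \<in> V" for c
    using V(1) B(2) by (intro subspace_sum subspace_scale) auto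
  have A_comb: "A (\<Sum>e\<in>B. c e *\<^sub>R e) = (\<Sum>e\<in>B. c e *\<^sub>R A e)" for c
  proof
    fix \<mu>
    show "A (\<Sum>e\<in>B. c e *\<^sub>R e) \<mu> = (\<Sum>e\<in>B. c e *\<^sub>R A e) \<mu>"
      using linear_form_on_combination[OF V(1) lin1, of \<mu> B "\<lambda>e. e" c] B(2) D(2)
      by (auto simp: A_def sum_fun_eval scaleR_fun_def)
  qed
  have A_inj: "u = 0" if "u \<in> V" "A u = 0" for u
  proof (rule nondeg[OF \<open>u \<in> V\<close>])
    fix \<mu> assume "\<mu> \<in> M"
    have "b u \<nu> = 0" if "\<nu> \<in> D" for \<nu>
      using fun_cong[OF \<open>A u = 0\<close>, of \<nu>] that by (simp add: A_def)
    then show "b u \<mu> = 0"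
      using linear_form_on_eqI[OF M(1) lin2[OF \<open>u \<in> V\<close>] _ D(2,4), of "\<lambda>_. 0" \<mu>] \<open>\<mu> \<in> M\<close>
      by (simp add: linear_form_on_def)
  qed
  have restr_in_span: "(\<lambda>\<mu>. if \<mu> \<in> D then f \<mu> else 0) \<in> span (\<delta> ` D)" for f
  proof -
    have "(\<lambda>\<mu>. if \<mu> \<in> D then f \<mu> else 0) = (\<Sum>\<nu>\<in>D. f \<nu> *\<^sub>R \<delta> \<nu>)"
      using D(1) by (auto simp: fun_eq_iff sum_fun_eval scaleR_fun_def \<delta>_def if_distrib sum.delta cong: if_cong)
    also have "\<dots> \<in> span (\<delta> ` D)"
      by (intro span_sum span_scale span_base) auto
    finally show ?thesis .
  qed
  then have A_in_span: "A u \<in> span (\<delta> ` D)" for u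
    by (simp add: A_def)
  have inj: "inj_on A B"
  proof (rule inj_onI)
    fix d e assume de: "d \<in> B" "e \<in> B" "A d = A e"
    have "A (d - e) \<mu> = 0" for \<mu>
      using fun_cong[OF de(3), of \<mu>] linear_form_on_diff[OF V(1) lin1, of \<mu> d e] de B(2) D(2)
      by (auto simp: A_def subset_iff)
    moreover have "d - e \<in> V" using de B(2) subspace_diff[OF V(1)] by blast
    ultimately have "d - e = 0" by (intro A_inj) (auto simp: fun_eq_iff)
    then show "d = e" by simp
  qed
  have "independent (A ` B)"
  proof (rule independent_if_scalars_zero)
    show "finite (A ` B)" using B(1) by simp
    fix c a assume c: "(\<Sum>a\<in>A ` B. c a *\<^sub>R a) = 0" and a: "a \<in> A ` B"
    obtain e where e: "e \<in> B" "a = A e" using a by blast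
    have "A (\<Sum>e\<in>B. c (A e) *\<^sub>R e) = 0"
      using c by (simp add: A_comb sum.reindex[OF inj])
    then have "(\<Sum>e\<in>B. c (A e) *\<^sub>R e) = 0" by (rule A_inj[OF comb_in_V])
    then have "c (A e) = 0" by (rule independentD[OF B(3,1) order_refl _ e(1)])
    then show "c a = 0" by (simp add: e)
  qed
  moreover have "inj_on \<delta> D"
    by (rule inj_onI) (metis \<delta>_def zero_neq_one)
  ultimately have "span (\<delta> ` D) \<subseteq> span (A ` B)"
    using B(5) D(1,5) dim
    by (intro span_superset_if_independent_card_eq) (simp_all add: card_image[OF inj] card_image A_in_span image_subset_iff)
  then have "(\<lambda>\<mu>. if \<mu> \<in> D then F \<mu> else 0) \<in> span (A ` B)" using restr_in_span by (rule subsetD)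
  then obtain c where "(\<lambda>\<mu>. if \<mu> \<in> D then F \<mu> else 0) = (\<Sum>a\<in>A ` B. c a *\<^sub>R a)"
    using B(1) by (auto simp: span_finite)
  then have *: "A (\<Sum>e\<in>B. c (A e) *\<^sub>R e) = (\<lambda>\<mu>. if \<mu> \<in> D then F \<mu> else 0)"
    by (simp add: A_comb sum.reindex[OF inj])
  let ?u = "\<Sum>e\<in>B. c (A e) *\<^sub>R e"
  have "b ?u \<nu> = F \<nu>" if "\<nu> \<in> D" for \<nu>
    using fun_cong[OF *, of \<nu>] that by (simp add: A_def)
  then have "b ?u \<mu> = F \<mu>" if "\<mu> \<in> M" for \<mu>
    by (rule linear_form_on_eqI[OF M(1) lin2[OF comb_in_V] F D(2,4) _ that])
  then show "\<exists>u. u \<in> V \<and> (\<forall>\<mu>\<in>M. b u \<mu> = F \<mu>)"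
    by (intro exI[of _ ?u] conjI comb_in_V ballI)
next
  fix u v assume uv: "u \<in> V \<and> (\<forall>\<mu>\<in>M. b u \<mu> = F \<mu>)" "v \<in> V \<and> (\<forall>\<mu>\<in>M. b v \<mu> = F \<mu>)"
  have "b (u - v) \<mu> = 0" if "\<mu> \<in> M" for \<mu>
    using linear_form_on_diff[OF V(1), of "\<lambda>u. b u \<mu>" u v] b uv that
    unfolding bilinear_form_on_def by simp
  then have "u - v = 0" using nondeg uv subspace_diff[OF V(1)] by blast
  then show "u = v" by simp
qed

text \<open>A definite form pairs \<open>V\<close> nondegenerately with itself, which gives unique solvability. By superposition
the solution with data \<open>z\<close> is \<open>\<Sum>k. z\<^sub>k w\<^sub>k\<close>, where \<open>w\<^sub>k\<close> solves the problem with the \<open>k\<close>-th unit vector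
as data. Expanding \<open>q\<close> at this sum bounds it by \<open>norm z ^ 2\<close> times the sum of all \<open>\<bar>q(w\<^sub>k, w\<^sub>l)\<bar>\<close>, which is
continuous dependence in any seminorm that comes from a bilinear form \<open>q\<close>.\<close>

theorem definite_form_well_posed:
  fixes V :: "'a::real_vector set" and P :: "'a \<Rightarrow> real^'N::finite"
  assumes V: "subspace V" "finite S" "V \<subseteq> span S"
    and a: "bilinear_form_on V V a" and definite: "\<And>u. u \<in> V \<Longrightarrow> a u u = 0 \<Longrightarrow> u = 0"
    and P: "\<And>k. linear_form_on V (\<lambda>v. P v $ k)"
    and q: "bilinear_form_on V V q"
  defines "solves z u \<equiv> u \<in> V \<and> (\<forall>v\<in>V. a u v = P v \<bullet> z)"
  shows "(\<forall>z. \<exists>!u. solves z u) \<and>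
    (\<exists>K. \<forall>z z' u u'. solves z u \<longrightarrow> solves z' u' \<longrightarrow> sqrt (q (u - u') (u - u')) \<le> K * norm (z - z'))"
proof
  have ex1: "\<exists>!u. solves z u" for z
  proof -
    have "linear_form_on V (\<lambda>v. P v \<bullet> z)"
      unfolding inner_vec_def using P linear_form_on_cmult[OF P]
      by (auto intro!: linear_form_on_sum simp: mult.commute)
    then show ?thesis
      unfolding solves_def using definite
      by (intro nondegenerate_pairing_represents[OF V V refl a]) auto
  qed
  then show "\<forall>z. \<exists>!u. solves z u" by blast
  have "\<exists>w. \<forall>k. solves (axis k 1) (w k)"
    by (rule choice) (use ex1 in blast)
  then obtain w where w: "\<And>k. solves (axis k 1) (w k)" by blast
  have wV: "w k \<in> V" for k using w by (simp add: solves_def)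
  have lin1: "linear_form_on V (\<lambda>u. a u v)" "linear_form_on V (\<lambda>u. q u v)" "linear_form_on V (q v)"
    if "v \<in> V" for v using a q that unfolding bilinear_form_on_def by auto
  have superpos: "solves z (\<Sum>k\<in>UNIV. z $ k *\<^sub>R w k)" for z
    unfolding solves_def
  proof (intro conjI ballI)
    show "(\<Sum>k\<in>UNIV. z $ k *\<^sub>R w k) \<in> V"
      using V(1) wV by (intro subspace_sum subspace_scale)
    fix v assume v: "v \<in> V"
    have "a (\<Sum>k\<in>UNIV. z $ k *\<^sub>R w k) v = (\<Sum>k\<in>UNIV. z $ k * a (w k) v)"
      by (rule linear_form_on_combination[OF V(1) lin1(1)[OF v] wV])
    also have "\<dots> = (\<Sum>k\<in>UNIV. z $ k * P v $ k)"
      using w v by (simp add: solves_def inner_axis)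
    finally show "a (\<Sum>k\<in>UNIV. z $ k *\<^sub>R w k) v = P v \<bullet> z"
      by (simp add: inner_vec_def mult.commute)
  qed
  define K where "K = (\<Sum>k\<in>UNIV. \<Sum>l\<in>UNIV. \<bar>q (w k) (w l)\<bar>)"
  have "sqrt (q (u - u') (u - u')) \<le> sqrt K * norm (z - z')"
    if "solves z u" "solves z' u'" for z z' u u'
  proof -
    let ?z = "z - z'"
    have "solves ?z (u - u')"
      using that V(1) linear_form_on_diff[OF V(1) lin1(1)]
      unfolding solves_def by (auto simp: subspace_diff inner_diff_right)
    then have u: "u - u' = (\<Sum>k\<in>UNIV. ?z $ k *\<^sub>R w k)" using ex1 superpos by metis
    have uV: "u - u' \<in> V" using \<open>solves ?z (u - u')\<close> by (simp add: solves_def)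
    have expand1: "q (u - u') (u - u') = (\<Sum>k\<in>UNIV. ?z $ k * q (w k) (u - u'))"
      by (subst (1) u) (rule linear_form_on_combination[OF V(1) lin1(2)[OF uV] wV])
    have "q (w k) (u - u') = (\<Sum>l\<in>UNIV. ?z $ l * q (w k) (w l))" for k
      by (subst u) (rule linear_form_on_combination[OF V(1) lin1(3)[OF wV] wV])
    then have expand2: "(\<Sum>k\<in>UNIV. ?z $ k * q (w k) (u - u')) =
        (\<Sum>k\<in>UNIV. \<Sum>l\<in>UNIV. ?z $ k * (?z $ l * q (w k) (w l)))"
      by (simp only: sum_distrib_left)
    note expand1
    also note expand2
    also have "\<dots> \<le> (\<Sum>k\<in>UNIV. \<Sum>l\<in>UNIV. norm ?z * (norm ?z * \<bar>q (w k) (w l)\<bar>))"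
    proof (intro sum_mono)
      fix k l
      have "?z $ k * (?z $ l * q (w k) (w l)) \<le> \<bar>?z $ k\<bar> * (\<bar>?z $ l\<bar> * \<bar>q (w k) (w l)\<bar>)"
        by (metis abs_ge_self abs_mult)
      also have "\<dots> \<le> norm ?z * (norm ?z * \<bar>q (w k) (w l)\<bar>)"
        by (intro mult_mono component_le_norm_cart) auto
      finally show "?z $ k * (?z $ l * q (w k) (w l)) \<le> norm ?z * (norm ?z * \<bar>q (w k) (w l)\<bar>)" .
    qed
    also have "\<dots> = K * (norm ?z)\<^sup>2"
      by (simp add: K_def sum_distrib_left[symmetric] power2_eq_square mult_ac)
    finally have "sqrt (q (u - u') (u - u')) \<le> sqrt (K * (norm ?z)\<^sup>2)" by simp
    then show ?thesis by (simp add: real_sqrt_mult)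
  qed
  then show "\<exists>K. \<forall>z z' u u'. solves z u \<longrightarrow> solves z' u' \<longrightarrow> sqrt (q (u - u') (u - u')) \<le> K * norm (z - z')"
    by blast
qed

section \<open>Square integrable functions\<close>

lemma L2_real_iff:
  fixes f :: "real^'d \<Rightarrow> real"
  shows "f \<in> L2 \<Omega> \<longleftrightarrow> f \<in> borel_measurable (lebesgue_on \<Omega>) \<and> integrable (lebesgue_on \<Omega>) (\<lambda>x. (f x)\<^sup>2)"
  by (simp add: L2_def)

lemma L2_mult_integrable:
  fixes f g :: "real^'d \<Rightarrow> real"
  assumes "f \<in> L2 \<Omega>" "g \<in> L2 \<Omega>"
  shows "integrable (lebesgue_on \<Omega>) (\<lambda>x. f x * g x)"
proof (rule Bochner_Integration.integrable_bound)
  show "integrable (lebesgue_on \<Omega>) (\<lambda>x. (f x)\<^sup>2 + (g x)\<^sup>2)"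
    using assms by (simp add: L2_real_iff)
  show "(\<lambda>x. f x * g x) \<in> borel_measurable (lebesgue_on \<Omega>)"
    using assms by (auto simp: L2_real_iff intro: borel_measurable_times)
  have "\<bar>a * b\<bar> \<le> \<bar>a\<^sup>2 + b\<^sup>2\<bar>" for a b :: real
  proof -
    have "2 * (\<bar>a\<bar> * \<bar>b\<bar>) \<le> a\<^sup>2 + b\<^sup>2" "0 \<le> \<bar>a\<bar> * \<bar>b\<bar>"
      using sum_squares_bound[of "\<bar>a\<bar>" "\<bar>b\<bar>"] by simp_all
    then have "\<bar>a\<bar> * \<bar>b\<bar> \<le> a\<^sup>2 + b\<^sup>2" by linarith
    then show ?thesis by (simp add: abs_mult)
  qed
  then show "AE x in lebesgue_on \<Omega>. norm (f x * g x) \<le> norm ((f x)\<^sup>2 + (g x)\<^sup>2)" by simp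
qed

lemma L2_add:
  fixes f g :: "real^'d \<Rightarrow> real"
  assumes "f \<in> L2 \<Omega>" "g \<in> L2 \<Omega>"
  shows "(\<lambda>x. f x + g x) \<in> L2 \<Omega>"
  using assms L2_mult_integrable[OF assms] by (auto simp: L2_real_iff power2_sum mult.assoc intro: borel_measurable_add)

lemma L2_cmult:
  fixes f :: "real^'d \<Rightarrow> real"
  assumes "f \<in> L2 \<Omega>"
  shows "(\<lambda>x. c * f x) \<in> L2 \<Omega>"
  using assms by (auto simp: L2_real_iff power_mult_distrib intro: borel_measurable_times)

lemma L2_diff:
  fixes f g :: "real^'d \<Rightarrow> real"
  assumes "f \<in> L2 \<Omega>" "g \<in> L2 \<Omega>"
  shows "(\<lambda>x. f x - g x) \<in> L2 \<Omega>"
  using L2_add[OF assms(1) L2_cmult[OF assms(2), of "-1"]] by simp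

lemma L2_sum:
  fixes f :: "'i \<Rightarrow> real^'d \<Rightarrow> real"
  assumes "\<And>i. i \<in> I \<Longrightarrow> f i \<in> L2 \<Omega>"
  shows "(\<lambda>x. \<Sum>i\<in>I. f i x) \<in> L2 \<Omega>"
  using assms
proof (induction I rule: infinite_finite_induct)
  case (insert i I)
  then have "(\<lambda>x. f i x + (\<Sum>i\<in>I. f i x)) \<in> L2 \<Omega>" by (intro L2_add) auto
  with insert.hyps show ?case by simp
qed (simp_all add: L2_real_iff)

lemma bounded_measurable_L2:
  fixes f :: "real^'d \<Rightarrow> real"
  assumes "\<Omega> \<in> lmeasurable" "f \<in> borel_measurable (lebesgue_on \<Omega>)" "\<And>x. x \<in> \<Omega> \<Longrightarrow> \<bar>f x\<bar> \<le> B"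
  shows "f \<in> L2 \<Omega>"
proof -
  have "integrable (lebesgue_on \<Omega>) (\<lambda>x. (f x)\<^sup>2)"
  proof (rule Bochner_Integration.integrable_bound)
    show "integrable (lebesgue_on \<Omega>) (\<lambda>_. B\<^sup>2)"
      using assms(1) by (simp add: integrable_on_const lmeasurable_iff_integrable integrable_restrict_space fmeasurableD)
    have "(f x)\<^sup>2 \<le> B\<^sup>2" if "x \<in> \<Omega>" for x
      using power_mono[OF assms(3)[OF that] abs_ge_zero, of 2] by simp
    then show "AE x in lebesgue_on \<Omega>. norm ((f x)\<^sup>2) \<le> norm (B\<^sup>2)" by (intro AE_I2) simp
  qed (use assms(2) in simp)
  with assms(2) show ?thesis by (simp add: L2_real_iff)
qed

lemma continuous_L2:
  fixes f :: "real^'d \<Rightarrow> real"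
  assumes "compact \<Omega>" "continuous_on \<Omega> f"
  shows "f \<in> L2 \<Omega>"
proof -
  obtain B where "\<And>x. x \<in> \<Omega> \<Longrightarrow> \<bar>f x\<bar> \<le> B"
    using compact_imp_bounded[OF compact_continuous_image[OF assms(2,1)]] by (auto simp: bounded_iff)
  then show ?thesis
    using assms by (intro bounded_measurable_L2 continuous_imp_measurable_on_sets_lebesgue)
      (auto intro: lmeasurable_compact fmeasurableD)
qed

lemma indicator_mult_L2:
  fixes f :: "real^'d \<Rightarrow> real"
  assumes "f \<in> L2 \<Omega>" and [measurable]: "A \<in> sets (lebesgue_on \<Omega>)"
  shows "(\<lambda>x. indicat_real A x * f x) \<in> L2 \<Omega>"
proof -
  have [measurable]: "f \<in> borel_measurable (lebesgue_on \<Omega>)" using assms(1) by (simp add: L2_real_iff)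
  have "integrable (lebesgue_on \<Omega>) (\<lambda>x. (f x)\<^sup>2)" using assms(1) by (simp add: L2_real_iff)
  then have "integrable (lebesgue_on \<Omega>) (\<lambda>x. (indicat_real A x * f x)\<^sup>2)"
    by (rule Bochner_Integration.integrable_bound) (auto simp: indicator_def intro!: AE_I2)
  then show ?thesis by (simp add: L2_real_iff)
qed

lemma L2_square_integral_eq_0_iff:
  fixes f :: "real^'d \<Rightarrow> real"
  assumes "f \<in> L2 \<Omega>"
  shows "(LINT y|lebesgue_on \<Omega>. f y * f y) = 0 \<longleftrightarrow> (AE y in lebesgue_on \<Omega>. f y = 0)"
  using integral_nonneg_eq_0_iff_AE[of "lebesgue_on \<Omega>" "\<lambda>y. f y * f y"] L2_mult_integrable[OF assms assms]
  by simp

lemma AE_lebesgue_on_iff_negligible: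
  assumes "S \<in> sets lebesgue"
  shows "(AE x in lebesgue_on S. P x) \<longleftrightarrow> negligible {x \<in> S. \<not> P x}"
proof -
  have "(AE x in lebesgue_on S. P x) \<longleftrightarrow> (AE x in lebesgue. x \<in> S \<longrightarrow> P x)"
    using assms by (simp add: AE_restrict_space_iff)
  also have "\<dots> \<longleftrightarrow> negligible {x \<in> S. \<not> P x}"
    by (simp add: completion.AE_iff_null_sets negligible_iff_null_sets)
  finally show ?thesis .
qed

text \<open>Lebesgue measure is complete, so measurability ignores null sets. This matters for gradients, whose values
on the faces of the simplices are unspecified.\<close>

lemma AE_eq_measurable_lebesgue_on:
  fixes f g :: "real^'d \<Rightarrow> real"
  assumes S: "S \<in> sets lebesgue" and f: "f \<in> borel_measurable (lebesgue_on S)"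
    and eq: "AE x in lebesgue_on S. f x = g x"
  shows "g \<in> borel_measurable (lebesgue_on S)"
proof -
  have "(\<lambda>x. if x \<in> S then f x else 0) \<in> borel_measurable lebesgue"
    using f S by (simp add: borel_measurable_if)
  moreover have "AE x in lebesgue. (if x \<in> S then f x else 0) = (if x \<in> S then g x else 0)"
    using eq S by (auto simp: AE_restrict_space_iff elim: eventually_mono)
  ultimately have "(\<lambda>x. if x \<in> S then g x else 0) \<in> borel_measurable lebesgue"
    by (rule borel_measurable_AE)
  then show ?thesis using S by (simp add: borel_measurable_if)
qed

lemma AE_eq_L2:
  fixes f g :: "real^'d \<Rightarrow> real"
  assumes S: "S \<in> sets lebesgue" and f: "f \<in> L2 S" and eq: "AE x in lebesgue_on S. f x = g x"
  shows "g \<in> L2 S"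
proof -
  have f': "f \<in> borel_measurable (lebesgue_on S)" using f by (simp add: L2_real_iff)
  have g: "g \<in> borel_measurable (lebesgue_on S)"
    by (rule AE_eq_measurable_lebesgue_on[OF S f' eq])
  have "integrable (lebesgue_on S) (\<lambda>x. (f x)\<^sup>2) \<longleftrightarrow> integrable (lebesgue_on S) (\<lambda>x. (g x)\<^sup>2)"
    using f' g eq by (intro integrable_cong_AE) auto
  with f g show ?thesis by (simp add: L2_real_iff)
qed

text \<open>A nonempty open set is not negligible, so the function vanishes in the interior of \<open>S\<close>, and this is dense in \<open>S\<close>.\<close>

lemma continuous_AE_zero_imp_zero:
  fixes f :: "real^'d \<Rightarrow> 'b::real_normed_vector"
  assumes S: "S \<subseteq> closure (interior S)" "S \<in> sets lebesgue" and f: "continuous_on S f"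
    and ae: "AE x in lebesgue_on S. f x = 0" and x: "x \<in> S"
  shows "f x = 0"
proof -
  have zero: "f y = 0" if "y \<in> interior S" for y
  proof -
    have "open (interior S \<inter> f -` (-{0}))"
      using f by (intro continuous_open_preimage) (auto intro: continuous_on_subset[OF _ interior_subset])
    moreover have "negligible (interior S \<inter> f -` (-{0}))"
      using ae[unfolded AE_lebesgue_on_iff_negligible[OF S(2)]]
      by (rule negligible_subset) (use interior_subset in auto)
    ultimately have "interior S \<inter> f -` (-{0}) = {}" using open_not_negligible by blast
    then show ?thesis using that by auto
  qed
  have "closedin (top_of_set S) (S \<inter> f -` {0})"
    using f by (intro continuous_closedin_preimage) auto
  then obtain K where K: "closed K" "S \<inter> f -` {0} = S \<inter> K" by (auto simp: closedin_closed)
  have "interior S \<subseteq> K" using zero K(2) interior_subset by fastforce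
  then have "closure (interior S) \<subseteq> K" using K(1) by (simp add: closure_minimal)
  then show ?thesis using K(2) S(1) x by auto
qed

section \<open>Maps into L2 that are linear almost everywhere\<close>

text \<open>The classical gradient of a sum is the sum of the gradients only at points of differentiability; at the
remaining points its value is unspecified. Linearity up to null sets is what survives, and it is all
that integrals can see.\<close>

definition ae_linear_on :: "(real^'d) set \<Rightarrow> 'a::real_vector set \<Rightarrow> ('a \<Rightarrow> real^'d \<Rightarrow> real) \<Rightarrow> bool"
  where "ae_linear_on \<Omega> V E \<longleftrightarrow> (\<forall>u\<in>V. E u \<in> L2 \<Omega>) \<and>
    (\<forall>u\<in>V. \<forall>v\<in>V. AE y in lebesgue_on \<Omega>. E (u + v) y = E u y + E v y) \<and>
    (\<forall>c. \<forall>u\<in>V. AE y in lebesgue_on \<Omega>. E (c *\<^sub>R u) y = c * E u y)"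

lemma ae_linear_onD:
  assumes "ae_linear_on \<Omega> V E" "u \<in> V"
  shows "E u \<in> L2 \<Omega>"
    and "v \<in> V \<Longrightarrow> AE y in lebesgue_on \<Omega>. E (u + v) y = E u y + E v y"
    and "AE y in lebesgue_on \<Omega>. E (c *\<^sub>R u) y = c * E u y"
  using assms unfolding ae_linear_on_def by blast+

lemma ae_linear_on_id:
  assumes "V \<subseteq> L2 \<Omega>"
  shows "ae_linear_on \<Omega> V (\<lambda>u. u)"
  using assms by (auto simp: ae_linear_on_def scaleR_fun_def)

lemma ae_linear_on_diff:
  assumes E: "ae_linear_on \<Omega> V E" and F: "ae_linear_on \<Omega> V F"
  shows "ae_linear_on \<Omega> V (\<lambda>u y. E u y - F u y)"
  unfolding ae_linear_on_def
proof (intro conjI ballI allI)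
  fix u v c assume u: "u \<in> V"
  show "(\<lambda>y. E u y - F u y) \<in> L2 \<Omega>" using u assms by (intro L2_diff ae_linear_onD)
  show "AE y in lebesgue_on \<Omega>. E (c *\<^sub>R u) y - F (c *\<^sub>R u) y = c * (E u y - F u y)"
    using ae_linear_onD(3)[OF E u, of c] ae_linear_onD(3)[OF F u, of c]
    by eventually_elim (simp add: algebra_simps)
  assume v: "v \<in> V"
  show "AE y in lebesgue_on \<Omega>. E (u + v) y - F (u + v) y = E u y - F u y + (E v y - F v y)"
    using ae_linear_onD(2)[OF E u v] ae_linear_onD(2)[OF F u v] by eventually_elim simp
qed

lemma ae_linear_on_compose:
  assumes E: "ae_linear_on \<Omega> V E" and f: "\<And>u. u \<in> W \<Longrightarrow> f u \<in> V"
    "\<And>u v. u \<in> W \<Longrightarrow> v \<in> W \<Longrightarrow> f (u + v) = f u + f v" "\<And>c u. u \<in> W \<Longrightarrow> f (c *\<^sub>R u) = c *\<^sub>R f u"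
  shows "ae_linear_on \<Omega> W (\<lambda>u. E (f u))"
  using E f unfolding ae_linear_on_def by auto

lemma linear_form_on_integral:
  fixes \<Omega> :: "(real^'d) set"
  assumes V: "subspace V" and E: "ae_linear_on \<Omega> V E" and g: "g \<in> L2 \<Omega>"
  shows "linear_form_on V (\<lambda>u. LINT y|lebesgue_on \<Omega>. E u y * g y)"
  unfolding linear_form_on_def
proof (intro conjI ballI allI)
  have meas: "f \<in> borel_measurable (lebesgue_on \<Omega>)" if "f \<in> L2 \<Omega>" for f :: "real^'d \<Rightarrow> real"
    using that by (simp add: L2_real_iff)
  note [measurable] = meas[OF g]
  fix u c assume u: "u \<in> V"
  have [measurable]: "E u \<in> borel_measurable (lebesgue_on \<Omega>)" "E (c *\<^sub>R u) \<in> borel_measurable (lebesgue_on \<Omega>)"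
    using u V by (auto intro!: meas ae_linear_onD(1)[OF E] subspace_scale)
  have "(LINT y|lebesgue_on \<Omega>. E (c *\<^sub>R u) y * g y) = (LINT y|lebesgue_on \<Omega>. c * (E u y * g y))"
    using ae_linear_onD(3)[OF E u, of c] by (intro integral_cong_AE) auto
  then show "(LINT y|lebesgue_on \<Omega>. E (c *\<^sub>R u) y * g y) = c * (LINT y|lebesgue_on \<Omega>. E u y * g y)"
    by simp
  fix v assume v: "v \<in> V"
  have [measurable]: "E v \<in> borel_measurable (lebesgue_on \<Omega>)" "E (u + v) \<in> borel_measurable (lebesgue_on \<Omega>)"
    using u v V by (auto intro!: meas ae_linear_onD(1)[OF E] subspace_add)
  have "(LINT y|lebesgue_on \<Omega>. E (u + v) y * g y) = (LINT y|lebesgue_on \<Omega>. E u y * g y + E v y * g y)"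
    using ae_linear_onD(2)[OF E u v] by (intro integral_cong_AE) (auto simp: distrib_right)
  also have "\<dots> = (LINT y|lebesgue_on \<Omega>. E u y * g y) + (LINT y|lebesgue_on \<Omega>. E v y * g y)"
    using u v g by (intro Bochner_Integration.integral_add L2_mult_integrable ae_linear_onD(1)[OF E])
  finally show "(LINT y|lebesgue_on \<Omega>. E (u + v) y * g y) =
    (LINT y|lebesgue_on \<Omega>. E u y * g y) + (LINT y|lebesgue_on \<Omega>. E v y * g y)" .
qed

lemma bilinear_form_on_integral:
  assumes "subspace V" "ae_linear_on \<Omega> V E" "subspace M" "ae_linear_on \<Omega> M F"
  shows "bilinear_form_on V M (\<lambda>u v. LINT y|lebesgue_on \<Omega>. E u y * F v y)"
proof -
  have "linear_form_on M (\<lambda>v. LINT y|lebesgue_on \<Omega>. E u y * F v y)" if "u \<in> V" for u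
    using linear_form_on_integral[OF assms(3,4) ae_linear_onD(1)[OF assms(2) that]]
    by (simp add: mult.commute)
  then show ?thesis
    using assms by (auto simp: bilinear_form_on_def intro: linear_form_on_integral ae_linear_onD)
qed

section \<open>Polynomials\<close>

text \<open>Continuous differentiability with an explicit gradient. Unlike the family of polynomials of
bounded degree, this class is closed under products, which gives the regularity of polynomials from that of
constants and coordinates.\<close>

definition C1 :: "(real^'d \<Rightarrow> real) \<Rightarrow> bool"
  where "C1 p \<longleftrightarrow>
    (\<exists>g. continuous_on UNIV g \<and> (\<forall>x. (p has_derivative (\<lambda>h. g x \<bullet> h)) (at x)))"

lemma C1_const: "C1 (\<lambda>_. c)"
  unfolding C1_def by (intro exI[of _ "\<lambda>_. 0"]) (auto intro!: derivative_eq_intros)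

lemma C1_coord: "C1 (\<lambda>x::real^'d. x $ i)"
proof -
  have "(\<lambda>h::real^'d. h $ i) = (\<lambda>h. axis i 1 \<bullet> h)" by (simp add: inner_axis')
  then show ?thesis
    unfolding C1_def
    by (intro exI[of _ "\<lambda>_. axis i 1"]) (metis bounded_linear_vec_nth bounded_linear_imp_has_derivative continuous_on_const)
qed

lemma C1_add:
  assumes "C1 p" "C1 q"
  shows "C1 (\<lambda>x. p x + q x)"
proof -
  obtain f g where "continuous_on UNIV f" "\<And>x. (p has_derivative (\<lambda>h. f x \<bullet> h)) (at x)"
    "continuous_on UNIV g" "\<And>x. (q has_derivative (\<lambda>h. g x \<bullet> h)) (at x)"
    using assms unfolding C1_def by blast
  then show ?thesis
    unfolding C1_def
    by (intro exI[of _ "\<lambda>x. f x + g x"]) (auto intro!: continuous_intros derivative_eq_intros simp: inner_add_left)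
qed

lemma C1_mult:
  assumes "C1 p" "C1 q"
  shows "C1 (\<lambda>x. p x * q x)"
proof -
  obtain f g where fg: "continuous_on UNIV f" "\<And>x. (p has_derivative (\<lambda>h. f x \<bullet> h)) (at x)"
    "continuous_on UNIV g" "\<And>x. (q has_derivative (\<lambda>h. g x \<bullet> h)) (at x)"
    using assms unfolding C1_def by blast
  have "continuous_on UNIV p" "continuous_on UNIV q"
    using fg(2,4) by (auto intro!: continuous_at_imp_continuous_on has_derivative_continuous)
  with fg show ?thesis
    unfolding C1_def
    by (intro exI[of _ "\<lambda>x. p x *\<^sub>R g x + q x *\<^sub>R f x"])
      (auto intro!: continuous_intros derivative_eq_intros simp: inner_add_left algebra_simps)
qed

lemma C1_power: "C1 p \<Longrightarrow> C1 (\<lambda>x. p x ^ n)"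
  by (induction n) (simp_all add: C1_const C1_mult)

lemma C1_prod: "(\<And>i. i \<in> I \<Longrightarrow> C1 (p i)) \<Longrightarrow> C1 (\<lambda>x. \<Prod>i\<in>I. p i x)"
  by (induction I rule: infinite_finite_induct) (simp_all add: C1_const C1_mult)

lemma C1_sum: "(\<And>i. i \<in> I \<Longrightarrow> C1 (p i)) \<Longrightarrow> C1 (\<lambda>x. \<Sum>i\<in>I. p i x)"
  by (induction I rule: infinite_finite_induct) (simp_all add: C1_const C1_add)

lemma polys_C1:
  assumes "p \<in> polys k"
  shows "C1 p"
proof -
  obtain c where "p = (\<lambda>x. \<Sum>m | (\<Sum>i\<in>UNIV. m i) \<le> k. c m * (\<Prod>i\<in>UNIV. (x $ i) ^ m i))"
    using assms unfolding polys_def by (auto simp: fun_eq_iff)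
  then show ?thesis
    by (auto intro!: C1_sum C1_mult C1_const C1_prod
        C1_power C1_coord)
qed

lemma finite_multi_indices: "finite {m :: 'd::finite \<Rightarrow> nat. (\<Sum>i\<in>UNIV. m i) \<le> k}"
proof (rule finite_subset)
  show "{m :: 'd \<Rightarrow> nat. (\<Sum>i\<in>UNIV. m i) \<le> k} \<subseteq> {m. \<forall>i. (i \<in> UNIV \<longrightarrow> m i \<in> {..k}) \<and> (i \<notin> UNIV \<longrightarrow> m i = 0)}"
  proof clarsimp
    fix m :: "'d \<Rightarrow> nat" and i assume "(\<Sum>i\<in>UNIV. m i) \<le> k"
    then show "m i \<le> k" using member_le_sum[of i UNIV m] by simp
  qed
  show "finite {m :: 'd \<Rightarrow> nat. \<forall>i. (i \<in> UNIV \<longrightarrow> m i \<in> {..k}) \<and> (i \<notin> UNIV \<longrightarrow> m i = 0)}"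
    by (rule finite_set_of_finite_funs) auto
qed

lemma polys_add: "p \<in> polys k \<Longrightarrow> q \<in> polys k \<Longrightarrow> (\<lambda>x. p x + q x) \<in> polys k"
proof -
  assume "p \<in> polys k" "q \<in> polys k"
  then obtain c d where
    "\<And>x. p x = (\<Sum>m | (\<Sum>i\<in>UNIV. m i) \<le> k. c m * (\<Prod>i\<in>UNIV. (x $ i) ^ m i))"
    "\<And>x. q x = (\<Sum>m | (\<Sum>i\<in>UNIV. m i) \<le> k. d m * (\<Prod>i\<in>UNIV. (x $ i) ^ m i))"
    unfolding polys_def by blast
  then show ?thesis
    unfolding polys_def by (auto intro!: exI[of _ "\<lambda>m. c m + d m"] simp: distrib_right sum.distrib)
qed

lemma polys_cmult: "p \<in> polys k \<Longrightarrow> (\<lambda>x. a * p x) \<in> polys k"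
proof -
  assume "p \<in> polys k"
  then obtain c where
    "\<And>x. p x = (\<Sum>m | (\<Sum>i\<in>UNIV. m i) \<le> k. c m * (\<Prod>i\<in>UNIV. (x $ i) ^ m i))"
    unfolding polys_def by blast
  then show ?thesis
    unfolding polys_def by (auto intro!: exI[of _ "\<lambda>m. a * c m"] simp: sum_distrib_left mult.assoc)
qed

lemma polys_const: "(\<lambda>_::real^'d. a) \<in> polys k"
proof -
  have "(\<Sum>m | (\<Sum>i\<in>UNIV. m i) \<le> k. (if m = (\<lambda>_::'d. 0) then a else 0) * (\<Prod>i\<in>UNIV. (x $ i) ^ m i)) = a"
    for x :: "real^'d"
  proof -
    have "(\<Sum>m | (\<Sum>i\<in>UNIV. m i) \<le> k. (if m = (\<lambda>_::'d. 0) then a else 0) * (\<Prod>i\<in>UNIV. (x $ i) ^ m i))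
      = (\<Sum>m | (\<Sum>i\<in>UNIV. m i) \<le> k. if m = (\<lambda>_::'d. 0) then a else 0)"
      by (intro sum.cong) auto
    also have "\<dots> = a" by (simp add: finite_multi_indices sum.delta)
    finally show ?thesis .
  qed
  then show ?thesis
    unfolding polys_def by (intro CollectI exI[of _ "\<lambda>m. if m = (\<lambda>_. 0) then a else 0"] allI) (rule sym)
qed

lemma grad_eqI:
  assumes "(f has_derivative (\<lambda>h. g \<bullet> h)) (at x)"
  shows "grad f x = g"
  using frechet_derivative_at[OF assms, symmetric] by (simp add: grad_def vec_eq_iff inner_axis)

section \<open>Lagrange spaces on a simplicial partition\<close>

locale simplicial_mesh =
  fixes \<Omega> :: "(real^'d) set" and \<T> :: "(real^'d) set set"
  assumes polyhedral: "polyhedral_region \<Omega>" and partition: "simplicial_partition \<Omega> \<T>"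
begin

lemma domain_properties: "compact \<Omega>" "connected \<Omega>" "\<Omega> \<subseteq> closure (interior \<Omega>)" "closed \<Omega>" "\<Omega> \<in> sets lebesgue"
proof -
  show *: "compact \<Omega>" "connected \<Omega>" "\<Omega> \<subseteq> closure (interior \<Omega>)"
    using polyhedral by (auto simp: polyhedral_region_def compact_eq_bounded_closed)
  from * show "closed \<Omega>" "\<Omega> \<in> sets lebesgue"
    by (auto intro: compact_imp_closed lmeasurable_compact fmeasurableD)
qed

lemma partition_properties: "finite \<T>" "\<T> \<noteq> {}" "\<Union>\<T> = \<Omega>"
  "S \<in> \<T> \<Longrightarrow> T \<in> \<T> \<Longrightarrow> x \<in> interior S \<Longrightarrow> x \<in> interior T \<Longrightarrow> S = T"
  using partition unfolding simplicial_partition_def by blast+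

text \<open>A closed convex set of full affine dimension is the closure of its nonempty interior. Thus facts that hold
inside a simplex extend to all of it by continuity.\<close>

lemma simplex_properties:
  assumes "T \<in> \<T>"
  shows "convex T" "interior T \<noteq> {}" "closure (interior T) = T" "T \<subseteq> \<Omega>"
proof -
  have T: "int CARD('d) simplex T" using assms partition by (simp add: simplicial_partition_def)
  show convex: "convex T" using T by (rule convex_simplex)
  show int: "interior T \<noteq> {}"
  proof
    assume "interior T = {}"
    then have "rel_interior T = {}"
      using interior_rel_interior[of T] aff_dim_simplex[OF T] by simp
    then have "T = {}" using rel_interior_eq_empty[OF convex] by simp
    then show False using aff_dim_simplex[OF T] by simp
  qed
  have "closed T"
    using T by (intro polytope_imp_closed simplex_imp_polytope)
  then show "closure (interior T) = T"
    using convex_closure_interior[OF convex int] by simp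
  show "T \<subseteq> \<Omega>" using assms partition_properties by blast
qed

text \<open>Boundaries of convex sets are negligible and there are finitely many simplices.\<close>

lemma AE_in_element_interior: "AE y in lebesgue_on \<Omega>. \<exists>T\<in>\<T>. y \<in> interior T"
proof -
  have "negligible (\<Union>(frontier ` \<T>))"
    using partition_properties(1) simplex_properties(1) by (intro negligible_Union) (auto simp: negligible_convex_frontier)
  moreover have "{y \<in> \<Omega>. \<not> (\<exists>T\<in>\<T>. y \<in> interior T)} \<subseteq> \<Union>(frontier ` \<T>)"
    using partition_properties(3) closure_subset unfolding frontier_def by blast
  ultimately show ?thesis
    unfolding AE_lebesgue_on_iff_negligible[OF domain_properties(5)] by (rule negligible_subset)
qed

lemma lagrange_space_subspace: "subspace (lagrange_space k \<Omega> \<T>)"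
  unfolding subspace_def
proof (intro conjI ballI allI)
  show "0 \<in> lagrange_space k \<Omega> \<T>"
    by (auto simp: lagrange_space_def zero_fun_def intro!: bexI[OF _ polys_const[of 0]])
  fix u c assume u: "u \<in> lagrange_space k \<Omega> \<T>"
  show "c *\<^sub>R u \<in> lagrange_space k \<Omega> \<T>"
    unfolding lagrange_space_def
  proof (intro CollectI conjI ballI)
    show "continuous_on \<Omega> (c *\<^sub>R u)" "\<forall>x. x \<notin> \<Omega> \<longrightarrow> (c *\<^sub>R u) x = 0"
      using u by (auto simp: lagrange_space_def scaleR_fun_def intro!: continuous_intros)
    fix T assume "T \<in> \<T>"
    then obtain p where "p \<in> polys k" "\<forall>x\<in>T. u x = p x" using u by (auto simp: lagrange_space_def)
    then show "\<exists>p\<in>polys k. \<forall>x\<in>T. (c *\<^sub>R u) x = p x"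
      by (intro bexI[OF _ polys_cmult[of p k c]]) (auto simp: scaleR_fun_def)
  qed
  fix v assume v: "v \<in> lagrange_space k \<Omega> \<T>"
  show "u + v \<in> lagrange_space k \<Omega> \<T>"
    unfolding lagrange_space_def
  proof (intro CollectI conjI ballI)
    show "continuous_on \<Omega> (u + v)" "\<forall>x. x \<notin> \<Omega> \<longrightarrow> (u + v) x = 0"
      using u v by (auto simp: lagrange_space_def plus_fun_def intro!: continuous_intros)
    fix T assume "T \<in> \<T>"
    then obtain p q where "p \<in> polys k" "\<forall>x\<in>T. u x = p x" "q \<in> polys k" "\<forall>x\<in>T. v x = q x"
      using u v by (auto simp: lagrange_space_def) blast
    then show "\<exists>p\<in>polys k. \<forall>x\<in>T. (u + v) x = p x"
      by (intro bexI[OF _ polys_add[of p k q]]) auto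
  qed
qed

text \<open>An element is determined by the coefficients of its polynomials on the finitely many simplices. The spanning
functions are the monomials cut off to disjoint pieces of \<open>\<Omega>\<close>; they need not lie in the space.\<close>

lemma lagrange_space_finite_dim: "\<exists>B. finite B \<and> lagrange_space k \<Omega> \<T> \<subseteq> span B"
proof -
  \<comment> \<open>A point on a common face belongs to several simplices; \<open>pick\<close> assigns it to one of them, so that each
    value of \<open>u\<close> is counted once.\<close>
  define pick where "pick y = (SOME T. T \<in> \<T> \<and> y \<in> T)" for y
  have pick: "pick y \<in> \<T>" "y \<in> pick y" if "y \<in> \<Omega>" for y
    using that partition_properties(3) someI_ex[of "\<lambda>T. T \<in> \<T> \<and> y \<in> T"] unfolding pick_def by blast+
  define I where "I = {m :: 'd \<Rightarrow> nat. (\<Sum>i\<in>UNIV. m i) \<le> k}"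
  define e where "e = (\<lambda>(T, m) y. if y \<in> \<Omega> \<and> pick y = T then (\<Prod>i\<in>UNIV. (y $ i) ^ m i) else 0 :: real)"
  have "u \<in> span (e ` (\<T> \<times> I))" if u: "u \<in> lagrange_space k \<Omega> \<T>" for u
  proof -
    have "\<forall>T\<in>\<T>. \<exists>c. \<forall>x\<in>T. u x = (\<Sum>m\<in>I. c m * (\<Prod>i\<in>UNIV. (x $ i) ^ m i))"
      using u unfolding lagrange_space_def polys_def I_def by fastforce
    then obtain c where c: "\<And>T x. T \<in> \<T> \<Longrightarrow> x \<in> T \<Longrightarrow> u x = (\<Sum>m\<in>I. c T m * (\<Prod>i\<in>UNIV. (x $ i) ^ m i))"
      by metis
    have "u = (\<Sum>T\<in>\<T>. \<Sum>m\<in>I. c T m *\<^sub>R e (T, m))"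
    proof
      fix y
      show "u y = (\<Sum>T\<in>\<T>. \<Sum>m\<in>I. c T m *\<^sub>R e (T, m)) y"
      proof (cases "y \<in> \<Omega>")
        case True
        have "(\<Sum>T\<in>\<T>. \<Sum>m\<in>I. c T m *\<^sub>R e (T, m)) y
          = (\<Sum>T\<in>\<T>. if pick y = T then \<Sum>m\<in>I. c T m * (\<Prod>i\<in>UNIV. (y $ i) ^ m i) else 0)"
          using True by (auto simp: sum_fun_eval scaleR_fun_def e_def intro!: sum.cong)
        also have "\<dots> = u y" using partition_properties(1) pick[OF True] c by (simp add: sum.delta)
        finally show ?thesis by simp
      next
        case False
        then show ?thesis using u by (simp add: sum_fun_eval scaleR_fun_def e_def lagrange_space_def)
      qed
    qed
    then show ?thesis by (auto intro!: span_sum span_scale intro: span_base)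
  qed
  moreover have "finite (e ` (\<T> \<times> I))" using partition_properties(1) finite_multi_indices[of k, where 'd = 'd] by (simp add: I_def)
  ultimately show ?thesis by blast
qed

text \<open>The constant \<open>1\<close> on \<open>\<Omega>\<close> is a nonzero element. Positivity is what makes \<open>dim\<close> informative for \<open>\<M>\<^sub>h\<close>, because
\<open>dim\<close> is \<open>0\<close> for spaces of infinite dimension.\<close>

lemma lagrange_space_dim_pos: "dim (lagrange_space k \<Omega> \<T>) > 0"
proof -
  let ?one = "\<lambda>x. if x \<in> \<Omega> then 1 else 0 :: real"
  have "?one \<in> lagrange_space k \<Omega> \<T>"
    unfolding lagrange_space_def
  proof (intro CollectI conjI ballI)
    show "continuous_on \<Omega> ?one" using continuous_on_cong[of \<Omega> \<Omega> ?one "\<lambda>_. 1"] by simp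
    fix T assume "T \<in> \<T>"
    then show "\<exists>p\<in>polys k. \<forall>x\<in>T. ?one x = p x"
      using simplex_properties(4) by (intro bexI[OF _ polys_const[of 1]]) auto
  qed auto
  moreover have "?one \<noteq> 0"
  proof -
    obtain T where "T \<in> \<T>" using partition_properties(2) by blast
    then obtain x where "x \<in> \<Omega>" using simplex_properties(2,4) interior_subset by blast
    then show ?thesis by (auto simp: fun_eq_iff)
  qed
  ultimately have "\<not> lagrange_space k \<Omega> \<T> \<subseteq> span {}" by auto
  moreover obtain S where "finite S" "lagrange_space k \<Omega> \<T> \<subseteq> span S"
    using lagrange_space_finite_dim by blast
  then obtain B where "finite B" "lagrange_space k \<Omega> \<T> \<subseteq> span B" "card B = dim (lagrange_space k \<Omega> \<T>)"
    by (rule finite_basis)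
  ultimately show ?thesis by (cases "B = {}") auto
qed

lemma lagrange_space_continuous: "u \<in> lagrange_space k \<Omega> \<T> \<Longrightarrow> continuous_on \<Omega> u"
  by (simp add: lagrange_space_def)

lemma lagrange_space_L2: "u \<in> lagrange_space k \<Omega> \<T> \<Longrightarrow> u \<in> L2 \<Omega>"
  by (intro continuous_L2 domain_properties lagrange_space_continuous)

lemma lagrange_space_eqI:
  assumes "u \<in> lagrange_space k \<Omega> \<T>" "\<And>x. x \<in> \<Omega> \<Longrightarrow> u x = 0"
  shows "u = 0"
  using assms by (auto simp: lagrange_space_def fun_eq_iff)

lemma lagrange_space_AE_zero:
  assumes "u \<in> lagrange_space k \<Omega> \<T>" "AE x in lebesgue_on \<Omega>. u x = 0"
  shows "u = 0"
  using assms continuous_AE_zero_imp_zero[OF domain_properties(3,5) lagrange_space_continuous]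
  by (blast intro: lagrange_space_eqI)

text \<open>The gradient \<open>g\<close> of the polynomial that represents \<open>u\<close> on \<open>T\<close> is continuous on the whole space. This gives
both the integrability of \<open>grad u\<close> and, later, the passage from almost every point of \<open>T\<close> to every point.\<close>

lemma lagrange_space_elementwise_derivative:
  assumes u: "u \<in> lagrange_space k \<Omega> \<T>" and T: "T \<in> \<T>"
  obtains g where "continuous_on UNIV g"
    "\<And>x. x \<in> interior T \<Longrightarrow> (u has_derivative (\<lambda>h. g x \<bullet> h)) (at x)"
proof -
  obtain p where p: "p \<in> polys k" "\<And>x. x \<in> T \<Longrightarrow> u x = p x" using u T by (auto simp: lagrange_space_def)
  obtain g where g: "continuous_on UNIV g" "\<And>x. (p has_derivative (\<lambda>h. g x \<bullet> h)) (at x)"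
    using polys_C1[OF p(1)] by (auto simp: C1_def)
  have "(u has_derivative (\<lambda>h. g x \<bullet> h)) (at x)" if "x \<in> interior T" for x
    by (rule has_derivative_transform_within_open[OF g(2) open_interior that])
      (metis p(2) interior_subset subsetD)
  with g(1) that show ?thesis by blast
qed

lemma lagrange_space_has_derivative:
  assumes "u \<in> lagrange_space k \<Omega> \<T>" "T \<in> \<T>" "y \<in> interior T"
  shows "(u has_derivative (\<lambda>h. grad u y \<bullet> h)) (at y)"
  using assms lagrange_space_elementwise_derivative grad_eqI by metis

text \<open>On \<open>\<Omega>\<close> the partial derivative agrees almost everywhere with a finite sum of continuous functions cut off
to the interiors of the simplices, hence is square integrable.\<close>

lemma grad_ae_linear: "ae_linear_on \<Omega> (lagrange_space k \<Omega> \<T>) (\<lambda>u y. grad u y $ i)"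
  unfolding ae_linear_on_def
proof (intro conjI ballI allI)
  fix u c assume u: "u \<in> lagrange_space k \<Omega> \<T>"
  have "\<exists>g. continuous_on UNIV g \<and> (\<forall>y\<in>interior T. grad u y = g y)" if "T \<in> \<T>" for T
    using lagrange_space_elementwise_derivative[OF u that] grad_eqI by metis
  then obtain g where g: "\<And>T. T \<in> \<T> \<Longrightarrow> continuous_on UNIV (g T)"
    "\<And>T y. T \<in> \<T> \<Longrightarrow> y \<in> interior T \<Longrightarrow> grad u y = g T y" by metis
  show "(\<lambda>y. grad u y $ i) \<in> L2 \<Omega>"
  proof (rule AE_eq_L2[OF domain_properties(5)])
    show "(\<lambda>y. \<Sum>T\<in>\<T>. indicat_real (interior T) y * g T y $ i) \<in> L2 \<Omega>"
    proof (intro L2_sum indicator_mult_L2 continuous_L2 domain_properties)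
      fix T assume T: "T \<in> \<T>"
      show "continuous_on \<Omega> (\<lambda>y. g T y $ i)"
        using g(1)[OF T] by (intro continuous_intros) (rule continuous_on_subset, auto)
      have "interior T \<subseteq> \<Omega>" using simplex_properties(4)[OF T] interior_subset by blast
      then show "interior T \<in> sets (lebesgue_on \<Omega>)"
        using domain_properties(5) by (simp add: sets_restrict_space_iff)
    qed
    show "AE y in lebesgue_on \<Omega>. (\<Sum>T\<in>\<T>. indicat_real (interior T) y * g T y $ i) = grad u y $ i"
      using AE_in_element_interior
    proof eventually_elim
      case (elim y)
      then obtain T where T: "T \<in> \<T>" "y \<in> interior T" by blast
      have "(\<Sum>S\<in>\<T>. indicat_real (interior S) y * g S y $ i) = (\<Sum>S\<in>\<T>. if S = T then g T y $ i else 0)"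
      proof (rule sum.cong[OF refl])
        fix S assume "S \<in> \<T>"
        then have "y \<in> interior S \<longleftrightarrow> S = T" using partition_properties(4)[OF _ T(1) _ T(2)] T(2) by blast
        then show "indicat_real (interior S) y * g S y $ i = (if S = T then g T y $ i else 0)"
          by (simp add: indicator_def)
      qed
      also have "\<dots> = g T y $ i" using T(1) partition_properties(1) by simp
      finally show ?case using g(2)[OF T] by simp
    qed
  qed
  show "AE y in lebesgue_on \<Omega>. grad (c *\<^sub>R u) y $ i = c * grad u y $ i"
    using AE_in_element_interior
  proof eventually_elim
    case (elim y)
    then obtain T where T: "T \<in> \<T>" "y \<in> interior T" by blast
    have "(c *\<^sub>R u has_derivative (\<lambda>h. (c *\<^sub>R grad u y) \<bullet> h)) (at y)"
      using has_derivative_scaleR_right[OF lagrange_space_has_derivative[OF u T], of c]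
      by (simp add: scaleR_fun_def)
    then have "grad (c *\<^sub>R u) y = c *\<^sub>R grad u y" by (rule grad_eqI)
    then show ?case by simp
  qed
  fix v assume v: "v \<in> lagrange_space k \<Omega> \<T>"
  show "AE y in lebesgue_on \<Omega>. grad (u + v) y $ i = grad u y $ i + grad v y $ i"
    using AE_in_element_interior
  proof eventually_elim
    case (elim y)
    then obtain T where T: "T \<in> \<T>" "y \<in> interior T" by blast
    have "(u + v has_derivative (\<lambda>h. (grad u y + grad v y) \<bullet> h)) (at y)"
      using has_derivative_add[OF lagrange_space_has_derivative[OF u T] lagrange_space_has_derivative[OF v T]]
      by (simp add: plus_fun_def inner_add_left)
    then have "grad (u + v) y = grad u y + grad v y" by (rule grad_eqI)
    then show ?case by simp
  qed
qed

text \<open>On each simplex \<open>u(x) - c \<bullet> x\<close> has a continuous gradient that vanishes almost everywhere, so it is constant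
there. A continuous function with finitely many values on the connected set \<open>\<Omega>\<close> is constant, so the
constants agree across simplices.\<close>

theorem constant_gradient_imp_affine:
  assumes u: "u \<in> lagrange_space k \<Omega> \<T>" and c: "AE y in lebesgue_on \<Omega>. grad u y = c"
  obtains b where "\<And>x. x \<in> \<Omega> \<Longrightarrow> u x = c \<bullet> x + b"
proof -
  define f where "f x = u x - c \<bullet> x" for x
  have cont: "continuous_on \<Omega> f"
    unfolding f_def by (intro continuous_intros lagrange_space_continuous[OF u])
  have "\<exists>a. \<forall>x\<in>T. f x = a" if T: "T \<in> \<T>" for T
  proof -
    obtain g where g: "continuous_on UNIV g"
      "\<And>x. x \<in> interior T \<Longrightarrow> (u has_derivative (\<lambda>h. g x \<bullet> h)) (at x)"
      using lagrange_space_elementwise_derivative[OF u T] by blast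
    have T\<Omega>: "interior T \<subseteq> \<Omega>" using simplex_properties(4)[OF T] interior_subset by blast
    have "g x - c = 0" if x: "x \<in> interior T" for x
    proof (rule continuous_AE_zero_imp_zero[OF _ _ _ _ x])
      show "continuous_on (interior T) (\<lambda>x. g x - c)"
        using g(1) by (intro continuous_intros) (rule continuous_on_subset, auto)
      have "negligible {y \<in> \<Omega>. grad u y \<noteq> c}" using c by (simp add: AE_lebesgue_on_iff_negligible[OF domain_properties(5)])
      then have "negligible {y \<in> interior T. \<not> g y - c = 0}"
        by (rule negligible_subset) (use grad_eqI[OF g(2)] T\<Omega> in auto)
      then show "AE y in lebesgue_on (interior T). g y - c = 0" by (simp add: AE_lebesgue_on_iff_negligible)
    qed (auto simp: closure_subset)
    then have "(f has_derivative (\<lambda>h. 0)) (at x)" if "x \<in> interior T" for x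
      unfolding f_def using g(2)[OF that] that by (auto intro!: derivative_eq_intros)
    then have const: "f x = f y" if "x \<in> interior T" "y \<in> interior T" for x y
      using that simplex_properties(1)[OF T]
      by (intro has_derivative_zero_unique_connected[of "interior T"]) (auto intro: convex_connected convex_interior)
    obtain y where y: "y \<in> interior T" using simplex_properties(2)[OF T] by blast
    have "f x = f y" if "x \<in> T" for x
    proof (rule continuous_constant_on_closure[of "interior T"])
      show "continuous_on (closure (interior T)) f"
        using continuous_on_subset[OF cont] simplex_properties(3,4)[OF T] by simp
      show "x \<in> closure (interior T)" using that simplex_properties(3)[OF T] by simp
    qed (rule const[OF _ y])
    then show ?thesis by blast
  qed
  then obtain a where "\<And>T x. T \<in> \<T> \<Longrightarrow> x \<in> T \<Longrightarrow> f x = a T" by metis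
  then have "f ` \<Omega> \<subseteq> a ` \<T>" using partition_properties(3) by blast
  then have "finite (f ` \<Omega>)" using partition_properties(1) finite_surj by blast
  then obtain b where "\<And>x. x \<in> \<Omega> \<Longrightarrow> f x = b"
    using continuous_finite_range_constant[OF domain_properties(2) cont] unfolding constant_on_def by blast
  with that show ?thesis unfolding f_def by (metis diff_eq_eq add.commute)
qed

end

section \<open>The recovery operator\<close>

locale stable_dual_space = simplicial_mesh +
  fixes M :: "(real^'d \<Rightarrow> real) set" and \<beta> :: real
  assumes M_subspace: "subspace M" and M_L2: "M \<subseteq> L2 \<Omega>"
    and M_dim: "dim M = dim (\<L> \<Omega> \<T>)" and inf_sup: "inf_sup_condition \<Omega> \<T> M \<beta>"
begin

text \<open>If \<open>\<phi>\<close> is orthogonal to \<open>M\<close>, then the supremum in the inf-sup condition is taken over the set \<open>{0}\<close>, so the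
\<open>L\<^sup>2\<close> norm of \<open>\<phi>\<close> is zero. For \<open>M = {0}\<close> the supremum would be one over the empty set and carry no
information; equality of the dimensions excludes this case.\<close>

lemma inf_sup_nondegenerate:
  assumes \<phi>: "\<phi> \<in> \<L> \<Omega> \<T>" and zero: "\<And>\<mu>. \<mu> \<in> M \<Longrightarrow> (LINT x|lebesgue_on \<Omega>. \<phi> x * \<mu> x) = 0"
  shows "\<phi> = 0"
proof -
  have "M - {0} \<noteq> {}"
  proof
    assume "M - {0} = {}"
    then have "M \<subseteq> span {}" by auto
    then have "dim M \<le> card ({} :: (real^'d \<Rightarrow> real) set)" by (intro dim_le_card) auto
    then show False using M_dim lagrange_space_dim_pos[of 1] by simp
  qed
  then have "(\<lambda>\<mu>. (LINT x|lebesgue_on \<Omega>. \<mu> x * \<phi> x) / L2_norm \<Omega> \<mu>) ` (M - {0}) = {0}"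
    using zero by (auto simp: mult.commute image_def)
  then have "L2_norm \<Omega> \<phi> \<le> 0"
    using inf_sup \<phi> unfolding inf_sup_condition_def by fastforce
  then have "(LINT x|lebesgue_on \<Omega>. (\<phi> x)\<^sup>2) \<le> 0" by (simp add: L2_norm_def)
  moreover have "(LINT x|lebesgue_on \<Omega>. (\<phi> x)\<^sup>2) \<ge> 0" by simp
  ultimately have "(LINT x|lebesgue_on \<Omega>. (\<phi> x)\<^sup>2) = 0" by linarith
  then have "(LINT x|lebesgue_on \<Omega>. \<phi> x * \<phi> x) = 0" by (simp add: power2_eq_square)
  then show ?thesis
    using L2_square_integral_eq_0_iff lagrange_space_L2[OF \<phi>] lagrange_space_AE_zero[OF \<phi>] by blast
qed

lemma R_op_ex1:
  assumes v: "v \<in> L2 \<Omega>"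
  shows "\<exists>!w. w \<in> \<L> \<Omega> \<T> \<and>
    (\<forall>\<mu>\<in>M. (LINT x|lebesgue_on \<Omega>. w x * \<mu> x) = (LINT x|lebesgue_on \<Omega>. v x * \<mu> x))"
proof -
  obtain S where S: "finite S" "\<L> \<Omega> \<T> \<subseteq> span S" using lagrange_space_finite_dim by blast
  obtain R where R: "R \<subseteq> M" "independent R" "M \<subseteq> span R" "card R = dim M"
    by (rule basis_exists)
  \<comment> \<open>A positive value of \<open>dim\<close> excludes an infinite basis.\<close>
  have "card R > 0" using R(4) M_dim lagrange_space_dim_pos[of 1] by simp
  then have "finite R" by (rule card_ge_0_finite)
  have idM: "ae_linear_on \<Omega> M (\<lambda>u. u)" using M_L2 by (rule ae_linear_on_id)
  have idL: "ae_linear_on \<Omega> (\<L> \<Omega> \<T>) (\<lambda>u. u)" using lagrange_space_L2 by (intro ae_linear_on_id) blast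
  show ?thesis
  proof (rule nondegenerate_pairing_represents[OF lagrange_space_subspace S M_subspace \<open>finite R\<close> R(3) M_dim])
    show "bilinear_form_on (\<L> \<Omega> \<T>) M (\<lambda>w \<mu>. LINT x|lebesgue_on \<Omega>. w x * \<mu> x)"
      by (rule bilinear_form_on_integral[OF lagrange_space_subspace idL M_subspace idM])
    show "linear_form_on M (\<lambda>\<mu>. LINT x|lebesgue_on \<Omega>. v x * \<mu> x)"
      using linear_form_on_integral[OF M_subspace idM v] by (simp add: mult.commute)
  qed (rule inf_sup_nondegenerate)
qed

lemma R_op_in: "v \<in> L2 \<Omega> \<Longrightarrow> R_op \<Omega> \<T> M v \<in> \<L> \<Omega> \<T>"
  and R_op_integral: "v \<in> L2 \<Omega> \<Longrightarrow> \<mu> \<in> M \<Longrightarrow>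
    (LINT x|lebesgue_on \<Omega>. R_op \<Omega> \<T> M v x * \<mu> x) = (LINT x|lebesgue_on \<Omega>. v x * \<mu> x)"
proof -
  assume "v \<in> L2 \<Omega>"
  from theI'[OF R_op_ex1[OF this]]
  have *: "R_op \<Omega> \<T> M v \<in> \<L> \<Omega> \<T> \<and> (\<forall>\<mu>\<in>M.
      (LINT x|lebesgue_on \<Omega>. R_op \<Omega> \<T> M v x * \<mu> x) = (LINT x|lebesgue_on \<Omega>. v x * \<mu> x))"
    unfolding R_op_def .
  then show "R_op \<Omega> \<T> M v \<in> \<L> \<Omega> \<T>" ..
  assume "\<mu> \<in> M"
  with * show "(LINT x|lebesgue_on \<Omega>. R_op \<Omega> \<T> M v x * \<mu> x) = (LINT x|lebesgue_on \<Omega>. v x * \<mu> x)"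
    by blast
qed

lemma R_op_eqI:
  assumes "v \<in> L2 \<Omega>" "w \<in> \<L> \<Omega> \<T>"
    "\<And>\<mu>. \<mu> \<in> M \<Longrightarrow> (LINT x|lebesgue_on \<Omega>. w x * \<mu> x) = (LINT x|lebesgue_on \<Omega>. v x * \<mu> x)"
  shows "R_op \<Omega> \<T> M v = w"
  unfolding R_op_def using assms by (intro the1_equality[OF R_op_ex1]) auto

text \<open>The operator sees its argument only through integrals against \<open>M\<close>, which ignore null sets. Hence
linearity almost everywhere of \<open>E\<close> becomes exact linearity of the composition.\<close>

lemma R_op_compose_linear:
  assumes W: "subspace W" and E: "ae_linear_on \<Omega> W E"
  shows "u \<in> W \<Longrightarrow> v \<in> W \<Longrightarrow> R_op \<Omega> \<T> M (E (u + v)) = R_op \<Omega> \<T> M (E u) + R_op \<Omega> \<T> M (E v)"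
    and "u \<in> W \<Longrightarrow> R_op \<Omega> \<T> M (E (c *\<^sub>R u)) = c *\<^sub>R R_op \<Omega> \<T> M (E u)"
proof -
  have idL: "ae_linear_on \<Omega> (\<L> \<Omega> \<T>) (\<lambda>u. u)" using lagrange_space_L2 by (intro ae_linear_on_id) blast
  have lin: "linear_form_on (\<L> \<Omega> \<T>) (\<lambda>w. LINT x|lebesgue_on \<Omega>. w x * \<mu> x)"
    "linear_form_on W (\<lambda>w. LINT x|lebesgue_on \<Omega>. E w x * \<mu> x)" if "\<mu> \<in> M" for \<mu>
    using linear_form_on_integral[OF lagrange_space_subspace idL] linear_form_on_integral[OF W E] that M_L2
    by blast+
  note EL2 = ae_linear_onD(1)[OF E]
  {
    assume u: "u \<in> W"
    show "R_op \<Omega> \<T> M (E (c *\<^sub>R u)) = c *\<^sub>R R_op \<Omega> \<T> M (E u)"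
    proof (rule R_op_eqI)
      fix \<mu> assume \<mu>: "\<mu> \<in> M"
      show "(LINT x|lebesgue_on \<Omega>. (c *\<^sub>R R_op \<Omega> \<T> M (E u)) x * \<mu> x) = (LINT x|lebesgue_on \<Omega>. E (c *\<^sub>R u) x * \<mu> x)"
        using lin[OF \<mu>] u R_op_in[OF EL2[OF u]] R_op_integral[OF EL2[OF u] \<mu>]
        unfolding linear_form_on_def by simp
    qed (intro EL2 R_op_in subspace_scale W lagrange_space_subspace u)+
    assume v: "v \<in> W"
    show "R_op \<Omega> \<T> M (E (u + v)) = R_op \<Omega> \<T> M (E u) + R_op \<Omega> \<T> M (E v)"
    proof (rule R_op_eqI)
      fix \<mu> assume \<mu>: "\<mu> \<in> M"
      have "(LINT x|lebesgue_on \<Omega>. (R_op \<Omega> \<T> M (E u) + R_op \<Omega> \<T> M (E v)) x * \<mu> x)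
        = (LINT x|lebesgue_on \<Omega>. E u x * \<mu> x) + (LINT x|lebesgue_on \<Omega>. E v x * \<mu> x)"
        using lin(1)[OF \<mu>] R_op_in[OF EL2[OF u]] R_op_in[OF EL2[OF v]]
          R_op_integral[OF EL2[OF u] \<mu>] R_op_integral[OF EL2[OF v] \<mu>]
        unfolding linear_form_on_def by (simp del: plus_fun_apply)
      also have "\<dots> = (LINT x|lebesgue_on \<Omega>. E (u + v) x * \<mu> x)"
        using lin(2)[OF \<mu>] u v unfolding linear_form_on_def by simp
      finally show "(LINT x|lebesgue_on \<Omega>. (R_op \<Omega> \<T> M (E u) + R_op \<Omega> \<T> M (E v)) x * \<mu> x)
        = (LINT x|lebesgue_on \<Omega>. E (u + v) x * \<mu> x)" .
    qed (intro EL2 R_op_in subspace_add W lagrange_space_subspace u v)+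
  }
qed

definition recovered_derivative :: "'d \<Rightarrow> (real^'d \<Rightarrow> real) \<Rightarrow> real^'d \<Rightarrow> real"
  where "recovered_derivative i u = R_op \<Omega> \<T> M (\<lambda>y. grad u y $ i)"

lemma recovered_derivative_linear:
  shows recovered_derivative_in: "u \<in> lagrange_space k \<Omega> \<T> \<Longrightarrow> recovered_derivative i u \<in> \<L> \<Omega> \<T>"
    and recovered_derivative_add: "u \<in> lagrange_space k \<Omega> \<T> \<Longrightarrow> v \<in> lagrange_space k \<Omega> \<T> \<Longrightarrow>
      recovered_derivative i (u + v) = recovered_derivative i u + recovered_derivative i v"
    and recovered_derivative_scale: "u \<in> lagrange_space k \<Omega> \<T> \<Longrightarrow> recovered_derivative i (c *\<^sub>R u) = c *\<^sub>R recovered_derivative i u"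
  unfolding recovered_derivative_def
  using R_op_in[OF ae_linear_onD(1)[OF grad_ae_linear]]
    R_op_compose_linear[OF lagrange_space_subspace grad_ae_linear]
  by blast+

section \<open>The variational form\<close>

definition recovered_hessian :: "'d \<Rightarrow> 'd \<Rightarrow> (real^'d \<Rightarrow> real) \<Rightarrow> real^'d \<Rightarrow> real"
  where "recovered_hessian i j u y = grad (recovered_derivative i u) y $ j"

definition recovery_defect :: "'d \<Rightarrow> (real^'d \<Rightarrow> real) \<Rightarrow> real^'d \<Rightarrow> real"
  where "recovery_defect i u y = recovered_derivative i u y - grad u y $ i"

lemma recovered_hessian_ae_linear: "ae_linear_on \<Omega> (lagrange_space k \<Omega> \<T>) (recovered_hessian i j)"
  unfolding recovered_hessian_def
  by (rule ae_linear_on_compose[where f = "recovered_derivative i", OF grad_ae_linear recovered_derivative_linear])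

lemma recovery_defect_ae_linear: "ae_linear_on \<Omega> (lagrange_space k \<Omega> \<T>) (recovery_defect i)"
proof -
  have "ae_linear_on \<Omega> (\<L> \<Omega> \<T>) (\<lambda>u. u)" using lagrange_space_L2 by (intro ae_linear_on_id) blast
  then have "ae_linear_on \<Omega> (lagrange_space k \<Omega> \<T>) (recovered_derivative i)"
    by (rule ae_linear_on_compose[where f = "recovered_derivative i", OF _ recovered_derivative_linear])
  then show ?thesis
    unfolding recovery_defect_def by (rule ae_linear_on_diff[OF _ grad_ae_linear])
qed

lemma a_form_eq:
  assumes u: "u \<in> lagrange_space k \<Omega> \<T>" and v: "v \<in> lagrange_space k \<Omega> \<T>"
  shows "a_form \<Omega> \<T> M \<alpha> x u v = (\<Sum>k\<in>UNIV. u (x k) * v (x k))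
    + \<alpha> * (\<Sum>i\<in>UNIV. \<Sum>j\<in>UNIV. LINT y|lebesgue_on \<Omega>. recovered_hessian i j u y * recovered_hessian i j v y)
    + (\<Sum>i\<in>UNIV. LINT y|lebesgue_on \<Omega>. recovery_defect i u y * recovery_defect i v y)"
proof -
  have H: "integrable (lebesgue_on \<Omega>) (\<lambda>y. recovered_hessian i j u y * recovered_hessian i j v y)" for i j
    by (intro L2_mult_integrable ae_linear_onD(1)[OF recovered_hessian_ae_linear u] ae_linear_onD(1)[OF recovered_hessian_ae_linear v])
  have D: "integrable (lebesgue_on \<Omega>) (\<lambda>y. recovery_defect i u y * recovery_defect i v y)" for i
    by (intro L2_mult_integrable ae_linear_onD(1)[OF recovery_defect_ae_linear u] ae_linear_onD(1)[OF recovery_defect_ae_linear v])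
  have "(LINT y|lebesgue_on \<Omega>. frobenius (grad_vec (R_vec \<Omega> \<T> M (grad u)) y) (grad_vec (R_vec \<Omega> \<T> M (grad v)) y))
    = (LINT y|lebesgue_on \<Omega>. (\<Sum>i\<in>UNIV. \<Sum>j\<in>UNIV. recovered_hessian i j u y * recovered_hessian i j v y))"
    by (simp add: frobenius_def grad_vec_def R_vec_def recovered_hessian_def recovered_derivative_def)
  also have "\<dots> = (\<Sum>i\<in>UNIV. \<Sum>j\<in>UNIV. LINT y|lebesgue_on \<Omega>. recovered_hessian i j u y * recovered_hessian i j v y)"
    using H by (simp add: Bochner_Integration.integral_sum Bochner_Integration.integrable_sum)
  finally have 1: "(LINT y|lebesgue_on \<Omega>. frobenius (grad_vec (R_vec \<Omega> \<T> M (grad u)) y) (grad_vec (R_vec \<Omega> \<T> M (grad v)) y))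
    = (\<Sum>i\<in>UNIV. \<Sum>j\<in>UNIV. LINT y|lebesgue_on \<Omega>. recovered_hessian i j u y * recovered_hessian i j v y)" .
  have "(LINT y|lebesgue_on \<Omega>. (R_vec \<Omega> \<T> M (grad u) y - grad u y) \<bullet> (R_vec \<Omega> \<T> M (grad v) y - grad v y))
    = (LINT y|lebesgue_on \<Omega>. (\<Sum>i\<in>UNIV. recovery_defect i u y * recovery_defect i v y))"
    by (simp add: inner_vec_def R_vec_def recovery_defect_def recovered_derivative_def)
  also have "\<dots> = (\<Sum>i\<in>UNIV. LINT y|lebesgue_on \<Omega>. recovery_defect i u y * recovery_defect i v y)"
    using D by (simp add: Bochner_Integration.integral_sum)
  finally show ?thesis unfolding a_form_def 1 by (simp add: P_vec_def inner_vec_def)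
qed

lemma a_form_bilinear:
  "bilinear_form_on (lagrange_space k \<Omega> \<T>) (lagrange_space k \<Omega> \<T>) (a_form \<Omega> \<T> M \<alpha> x)"
proof (rule bilinear_form_on_cong[OF lagrange_space_subspace lagrange_space_subspace])
  let ?V = "lagrange_space k \<Omega> \<T>"
  have points: "bilinear_form_on ?V ?V (\<lambda>u v. u (x k) * v (x k))" for k
    by (simp add: bilinear_form_on_def linear_form_on_def scaleR_fun_def distrib_left distrib_right)
  have hess: "bilinear_form_on ?V ?V (\<lambda>u v. LINT y|lebesgue_on \<Omega>. recovered_hessian i j u y * recovered_hessian i j v y)" for i j
    by (rule bilinear_form_on_integral[OF lagrange_space_subspace recovered_hessian_ae_linear
        lagrange_space_subspace recovered_hessian_ae_linear])
  have recovery_defect: "bilinear_form_on ?V ?V (\<lambda>u v. LINT y|lebesgue_on \<Omega>. recovery_defect i u y * recovery_defect i v y)" for i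
    by (rule bilinear_form_on_integral[OF lagrange_space_subspace recovery_defect_ae_linear
        lagrange_space_subspace recovery_defect_ae_linear])
  show "bilinear_form_on ?V ?V (\<lambda>u v. (\<Sum>k\<in>UNIV. u (x k) * v (x k))
    + \<alpha> * (\<Sum>i\<in>UNIV. \<Sum>j\<in>UNIV. LINT y|lebesgue_on \<Omega>. recovered_hessian i j u y * recovered_hessian i j v y)
    + (\<Sum>i\<in>UNIV. LINT y|lebesgue_on \<Omega>. recovery_defect i u y * recovery_defect i v y))"
    by (intro bilinear_form_on_add bilinear_form_on_cmult bilinear_form_on_sum points hess recovery_defect)
qed (rule a_form_eq)

text \<open>Vanishing second derivatives make the recovered gradient constant, a vanishing defect makes it the gradient
of \<open>u\<close>, and an affine function that is zero at points on no common hyperplane is zero.\<close>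

lemma a_form_definite:
  assumes "\<alpha> > 0" and x: "range x \<subseteq> \<Omega>"
    and not_flat: "\<And>c b. c \<noteq> 0 \<Longrightarrow> \<not> range x \<subseteq> {y. c \<bullet> y = b}"
    and u: "u \<in> lagrange_space k \<Omega> \<T>" and zero: "a_form \<Omega> \<T> M \<alpha> x u u = 0"
  shows "u = 0"
proof -
  let ?P = "\<Sum>k\<in>UNIV. u (x k) * u (x k)"
  let ?H = "\<Sum>i\<in>UNIV. \<Sum>j\<in>UNIV. LINT y|lebesgue_on \<Omega>. recovered_hessian i j u y * recovered_hessian i j u y"
  let ?D = "\<Sum>i\<in>UNIV. LINT y|lebesgue_on \<Omega>. recovery_defect i u y * recovery_defect i u y"
  have "?P \<ge> 0" "?H \<ge> 0" "?D \<ge> 0" by (auto intro!: sum_nonneg integral_nonneg_AE)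
  moreover have "?P + \<alpha> * ?H + ?D = 0" using zero by (simp add: a_form_eq[OF u u])
  ultimately have zeros: "?P = 0" "?H = 0" "?D = 0"
    using \<open>\<alpha> > 0\<close> mult_nonneg_nonneg[of \<alpha> ?H] by (smt (verit) mult_eq_0_iff)+
  have at_points: "u (x k) = 0" for k
    using zeros(1) by (subst (asm) sum_nonneg_eq_0_iff) auto
  have "(LINT y|lebesgue_on \<Omega>. recovered_hessian i j u y * recovered_hessian i j u y) = 0" for i j
    using zeros(2) by (subst (asm) sum_nonneg_eq_0_iff, simp_all add: sum_nonneg integral_nonneg_AE)
      (subst (asm) sum_nonneg_eq_0_iff, simp_all add: integral_nonneg_AE)
  then have hess: "AE y in lebesgue_on \<Omega>. recovered_hessian i j u y = 0" for i j
    using L2_square_integral_eq_0_iff[OF ae_linear_onD(1)[OF recovered_hessian_ae_linear u]] by blast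
  have "(LINT y|lebesgue_on \<Omega>. recovery_defect i u y * recovery_defect i u y) = 0" for i
    using zeros(3) by (subst (asm) sum_nonneg_eq_0_iff) (auto simp: integral_nonneg_AE)
  then have recovery_defect: "AE y in lebesgue_on \<Omega>. recovery_defect i u y = 0" for i
    using L2_square_integral_eq_0_iff[OF ae_linear_onD(1)[OF recovery_defect_ae_linear u]] by blast
  \<comment> \<open>Zero energy of the recovered gradient makes it a constant vector, \<open>c\<close> below.\<close>
  have "\<exists>b. \<forall>y\<in>\<Omega>. recovered_derivative i u y = b" for i
  proof -
    have "AE y in lebesgue_on \<Omega>. \<forall>j. recovered_hessian i j u y = 0" using hess by (simp add: AE_all_countable)
    then have "AE y in lebesgue_on \<Omega>. grad (recovered_derivative i u) y = 0"
      by eventually_elim (simp add: recovered_hessian_def vec_eq_iff)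
    then obtain b where "\<And>y. y \<in> \<Omega> \<Longrightarrow> recovered_derivative i u y = 0 \<bullet> y + b"
      using constant_gradient_imp_affine[OF recovered_derivative_in[OF u]] by blast
    then show ?thesis by auto
  qed
  then obtain b where b: "\<And>i y. y \<in> \<Omega> \<Longrightarrow> recovered_derivative i u y = b i" by metis
  define c where "c = (\<chi> i. b i)"
  have "AE y in lebesgue_on \<Omega>. \<forall>i. recovery_defect i u y = 0" using recovery_defect by (simp add: AE_all_countable)
  moreover have "AE y in lebesgue_on \<Omega>. y \<in> \<Omega>" by (auto intro!: AE_I2)
  ultimately have "AE y in lebesgue_on \<Omega>. grad u y = c"
    by eventually_elim (simp add: recovery_defect_def vec_eq_iff c_def b)
  then obtain d where d: "\<And>y. y \<in> \<Omega> \<Longrightarrow> u y = c \<bullet> y + d"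
    using constant_gradient_imp_affine[OF u] by blast
  have on_plane: "c \<bullet> x k = - d" for k
    using d[of "x k"] at_points[of k] x by (auto simp: add_eq_0_iff2)
  then have "range x \<subseteq> {y. c \<bullet> y = - d}" by auto
  then have "c = 0" using not_flat by blast
  moreover from this on_plane have "d = 0" by simp
  ultimately show ?thesis using d by (intro lagrange_space_eqI[OF u]) simp
qed

text \<open>The inner product whose quadratic form is the square of the \<open>H\<^sup>1\<close> norm on finite element functions.\<close>

definition H1_form :: "(real^'d \<Rightarrow> real) \<Rightarrow> (real^'d \<Rightarrow> real) \<Rightarrow> real"
  where "H1_form u v = (LINT y|lebesgue_on \<Omega>. u y * v y)
    + (\<Sum>i\<in>UNIV. LINT y|lebesgue_on \<Omega>. grad u y $ i * grad v y $ i)"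

lemma H1_form_bilinear:
  "bilinear_form_on (lagrange_space k \<Omega> \<T>) (lagrange_space k \<Omega> \<T>) H1_form"
proof -
  have "ae_linear_on \<Omega> (lagrange_space k \<Omega> \<T>) (\<lambda>u. u)"
    using lagrange_space_L2 by (intro ae_linear_on_id) blast
  then show ?thesis
    unfolding H1_form_def
    by (intro bilinear_form_on_add bilinear_form_on_sum bilinear_form_on_integral
        lagrange_space_subspace grad_ae_linear)
qed

lemma fe_H1_norm_eq:
  assumes u: "u \<in> lagrange_space k \<Omega> \<T>"
  shows "fe_H1_norm \<Omega> u = sqrt (H1_form u u)"
proof -
  have "integrable (lebesgue_on \<Omega>) (\<lambda>y. grad u y $ i * grad u y $ i)" for i
    by (intro L2_mult_integrable ae_linear_onD(1)[OF grad_ae_linear u])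
  then have grad: "(LINT y|lebesgue_on \<Omega>. (norm (grad u y))\<^sup>2) = (\<Sum>i\<in>UNIV. LINT y|lebesgue_on \<Omega>. grad u y $ i * grad u y $ i)"
    by (simp add: power2_norm_eq_inner inner_vec_def Bochner_Integration.integral_sum)
  have "fe_H1_norm \<Omega> u = sqrt ((LINT y|lebesgue_on \<Omega>. (u y)\<^sup>2) + (LINT y|lebesgue_on \<Omega>. (norm (grad u y))\<^sup>2))"
    by (simp add: fe_H1_norm_def L2_norm_def)
  then show ?thesis unfolding grad H1_form_def by (simp add: power2_eq_square)
qed

end

section \<open>Well-posedness of the discrete problem\<close>

text \<open>An affine basis of \<open>S\<close> has at most three points. This turns the definition of \<open>coplanar\<close> by three spanning
points into a bound on the dimension, as needed to compare with hyperplanes.\<close>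

lemma aff_dim_le_2_imp_coplanar:
  fixes S :: "'a::euclidean_space set"
  assumes "aff_dim S \<le> 2"
  shows "coplanar S"
proof -
  obtain B where B: "\<not> affine_dependent B" "B \<subseteq> S" "affine hull S = affine hull B"
    using affine_basis_exists by metis
  have "int (card B) = aff_dim S + 1" using aff_dim_unique[of B S] B by simp
  then have "coplanar B" using assms aff_independent_finite[OF B(1)] by (intro coplanar_small) auto
  then show ?thesis
    using B(3) coplanar_affine_hull_coplanar[of S] coplanar_affine_hull_coplanar[of B] by simp
qed

theorem corollary1:
  fixes \<Omega> :: "(real^'d) set"
    and H :: "real set"
    and \<T> :: "real \<Rightarrow> (real^'d) set set"
    and M :: "real \<Rightarrow> (real^'d \<Rightarrow> real) set"
    and x :: "'N::finite \<Rightarrow> real^'d"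
    and \<alpha> \<beta> C h :: real
    and W :: "(real^'d \<Rightarrow> real) set"
  assumes "CARD('d) \<in> {2, 3}"
    and "polyhedral_region \<Omega>"
    and "quasi_uniform_partitions \<Omega> H \<T>"
    and "\<And>h. h \<in> H \<Longrightarrow> subspace (M h) \<and> M h \<subseteq> L2 \<Omega> \<and> (\<forall>\<mu>\<in>M h. piecewise_polynomial (\<T> h) \<mu>)"
    and "\<And>h. h \<in> H \<Longrightarrow> dim (M h) = dim (\<L> \<Omega> (\<T> h))"
    and "\<beta> > 0" and "\<And>h. h \<in> H \<Longrightarrow> inf_sup_condition \<Omega> (\<T> h) (M h) \<beta>"
    and "\<And>h. h \<in> H \<Longrightarrow> approximation_property \<Omega> (M h) C h"
    and "\<alpha> > 0"
    and "range x \<subseteq> closure \<Omega>"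
    and "CARD('d) = 2 \<Longrightarrow> \<exists>i j k. \<not> collinear {x i, x j, x k}"
    and "CARD('d) = 3 \<Longrightarrow> \<exists>i j k l. \<not> coplanar {x i, x j, x k, x l}"
    and "h \<in> H"
    and "W = \<L> \<Omega> (\<T> h) \<or> W = \<Q> \<Omega> (\<T> h)"
  shows "(\<forall>z. \<exists>!u. is_solution \<Omega> (\<T> h) (M h) \<alpha> x W z u) \<and>
    (\<exists>K. \<forall>z z' u u'. is_solution \<Omega> (\<T> h) (M h) \<alpha> x W z u \<longrightarrow>
        is_solution \<Omega> (\<T> h) (M h) \<alpha> x W z' u' \<longrightarrow>
        fe_H1_norm \<Omega> (\<lambda>y. u y - u' y) \<le> K * norm (z - z'))"
proof -
  interpret stable_dual_space \<Omega> "\<T> h" "M h" \<beta>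
  proof
    show "polyhedral_region \<Omega>" by fact
    show "simplicial_partition \<Omega> (\<T> h)"
      using assms(3,13) unfolding quasi_uniform_partitions_def by blast
    show "subspace (M h)" "M h \<subseteq> L2 \<Omega>" using assms(4)[OF assms(13)] by blast+
    show "dim (M h) = dim (\<L> \<Omega> (\<T> h))" by (rule assms(5)[OF assms(13)])
    show "inf_sup_condition \<Omega> (\<T> h) (M h) \<beta>" by (rule assms(7)[OF assms(13)])
  qed
  obtain k where W: "W = lagrange_space k \<Omega> (\<T> h)" using assms(14) by blast
  obtain S where S: "finite S" "lagrange_space k \<Omega> (\<T> h) \<subseteq> span S" using lagrange_space_finite_dim by blast
  \<comment> \<open>A hyperplane has affine dimension one less than the space, so all of its subsets are collinear in the
    plane and coplanar in space.\<close>
  have not_flat: "\<not> range x \<subseteq> {y. c \<bullet> y = b}" if c: "c \<noteq> 0" for c b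
  proof
    assume plane: "range x \<subseteq> {y. c \<bullet> y = b}"
    have small: "aff_dim S \<le> int CARD('d) - 1" if "S \<subseteq> range x" for S
      using aff_dim_subset[of S "{y. c \<bullet> y = b}"] aff_dim_hyperplane[OF c, of b] that plane by auto
    consider "CARD('d) = 2" | "CARD('d) = 3" using assms(1) by blast
    then show False
    proof cases
      case 1
      then obtain i j k where "\<not> collinear {x i, x j, x k}" using assms(11) by blast
      then show False using small[of "{x i, x j, x k}"] 1 by (simp add: collinear_aff_dim)
    next
      case 2
      then obtain i j k l where "\<not> coplanar {x i, x j, x k, x l}" using assms(12) by blast
      then show False using small[of "{x i, x j, x k, x l}"] 2 aff_dim_le_2_imp_coplanar by fastforce
    qed
  qed
  have x: "range x \<subseteq> \<Omega>" using assms(10) domain_properties(4) by simp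
  have P: "linear_form_on (lagrange_space k \<Omega> (\<T> h)) (\<lambda>v. P_vec x v $ i)" for i
    by (simp add: P_vec_def linear_form_on_def scaleR_fun_def)
  have well_posed: "(\<forall>z. \<exists>!u. is_solution \<Omega> (\<T> h) (M h) \<alpha> x W z u) \<and>
    (\<exists>K. \<forall>z z' u u'. is_solution \<Omega> (\<T> h) (M h) \<alpha> x W z u \<longrightarrow>
      is_solution \<Omega> (\<T> h) (M h) \<alpha> x W z' u' \<longrightarrow> sqrt (H1_form (u - u') (u - u')) \<le> K * norm (z - z'))"
    unfolding is_solution_def W
    by (rule definite_form_well_posed[OF lagrange_space_subspace S a_form_bilinear _ P H1_form_bilinear])
      (rule a_form_definite[OF \<open>\<alpha> > 0\<close> x not_flat])
  have norm_eq: "fe_H1_norm \<Omega> (\<lambda>y. u y - u' y) = sqrt (H1_form (u - u') (u - u'))"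
    if "u \<in> W" "u' \<in> W" for u u'
    using fe_H1_norm_eq[OF subspace_diff[OF lagrange_space_subspace that[unfolded W]]]
    by (simp add: fun_diff_def)
  from well_posed obtain K where K: "sqrt (H1_form (u - u') (u - u')) \<le> K * norm (z - z')"
    if "is_solution \<Omega> (\<T> h) (M h) \<alpha> x W z u" "is_solution \<Omega> (\<T> h) (M h) \<alpha> x W z' u'" for z z' u u'
    by blast
  show ?thesis
  proof (intro conjI exI[of _ K] allI impI)
    show "\<exists>!u. is_solution \<Omega> (\<T> h) (M h) \<alpha> x W z u" for z using well_posed by blast
    fix z z' u u'
    assume sol: "is_solution \<Omega> (\<T> h) (M h) \<alpha> x W z u" "is_solution \<Omega> (\<T> h) (M h) \<alpha> x W z' u'"
    then have "u \<in> W" "u' \<in> W" by (simp_all add: is_solution_def)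
    then show "fe_H1_norm \<Omega> (\<lambda>y. u y - u' y) \<le> K * norm (z - z')"
      using K[OF sol] by (simp add: norm_eq)
  qed
qed

end
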